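(* Let $d \ge 2$ and let $f$ be a probability density on $\mathbb{R}$ such that $f$ is not a Gaussian density and $\int |x|^m f(x)\,dx < \infty$ for all $m > 0$. For $\lambda \in (0,\infty)$ let $f_\lambda(x) = \lambda f(\lambda x)$. Let $X = (X_1,\ldots,X_d)^\top$ be a random vector with independent components $X_j \sim f_{\lambda_j}$, where $\lambda_j > 0$, $1 \le j \le d$. Let $\epsilon$ be a real random variable independent of $X$ such that the set of zeros of the characteristic function of $\epsilon$ does not contain any nonempty open interval as a subset. Let $\beta_0 = (\beta_{01},\ldots,\beta_{0d})^\top \in \mathbb{R}^d$ and let $Y$ be a real random variable with $Y \overset{d}{=} \beta_0^\top X + \epsilon$. Put $\mathcal{B}_0 = \{\beta \in \mathbb{R}^d : Y \overset{d}{=} \beta^\top X + \epsilon\}$. Then $$\Big\{\beta \in \mathbb{R}^d : \exists \text{ a permutation } \sigma \text{ of } \{1,\ldots,d\} \text{ with } \beta_j = \tfrac{\lambda_j}{\lambda_{\sigma(j)}} \beta_{0\sigma(j)} \text{ for all } j\Big\} \subseteq \mathcal{B}_0$$ and $$\mathcal{B}_0 \subseteq \Big\{\beta \in \mathbb{R}^d : \exists \text{ a permutation } \sigma \text{ of } \{1,\ldots,d\} \text{ with } |\beta_j| = \tfrac{\lambda_j}{\lambda_{\sigma(j)}} |\beta_{0\sigma(j)}| \text{ for all } j\Big\}.$$ Moreover, if $f$ is symmetric around $0$, then the second inclusion is an equality.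
   Context: $\overset{d}{=}$ denotes equality in distribution. "Gaussian density" means the density of $\mathcal{N}(\mu,\sigma^2)$ for some $\mu \in \mathbb{R}$, $\sigma > 0$. *)

theory Defs
  imports "HOL-Probability.Probability"
begin

definition prob_density :: "(real \<Rightarrow> real) \<Rightarrow> bool" where
  "prob_density f \<longleftrightarrow>
     (\<forall>x. 0 \<le> f x) \<and> integrable lborel f \<and> integral\<^sup>L lborel f = 1"

text \<open>A density is determined only up to a Lebesgue null set, so being Gaussian and being symmetric
  are properties up to null sets. (A normal density altered at a single point must still count as
  Gaussian.)\<close>

definition gaussian_density :: "(real \<Rightarrow> real) \<Rightarrow> bool" where
  "gaussian_density f \<longleftrightarrow>
     (\<exists>\<mu> \<sigma>. 0 < \<sigma> \<and> (AE x in lborel. f x = normal_density \<mu> \<sigma> x))"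

definition symmetric_density :: "(real \<Rightarrow> real) \<Rightarrow> bool" where
  "symmetric_density f \<longleftrightarrow> (AE x in lborel. f (- x) = f x)"

definition scaled_density :: "real \<Rightarrow> (real \<Rightarrow> real) \<Rightarrow> real \<Rightarrow> real" where
  "scaled_density l f x = l * f (l * x)"

text \<open>The library's \<^const>\<open>prob_space.indep_var\<close> requires both variables to have the same value type;
  this is its characterisation \<open>indep_var_eq\<close> with two value types.\<close>

definition (in prob_space) indep_rv ::
  "'b measure \<Rightarrow> ('a \<Rightarrow> 'b) \<Rightarrow> 'c measure \<Rightarrow> ('a \<Rightarrow> 'c) \<Rightarrow> bool" where
  "indep_rv S U T V \<longleftrightarrow>
     random_variable S U \<and> random_variable T V \<and>
     indep_set (sigma_sets (space M) {U -` A \<inter> space M | A. A \<in> sets S})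
               (sigma_sets (space M) {V -` A \<inter> space M | A. A \<in> sets T})"

text \<open>The two random variables may live on different probability spaces.\<close>

definition eq_in_distr ::
  "'b measure \<Rightarrow> ('b \<Rightarrow> real) \<Rightarrow> 'a measure \<Rightarrow> ('a \<Rightarrow> real) \<Rightarrow> bool" where
  "eq_in_distr N Y M Z \<longleftrightarrow> distr N borel Y = distr M borel Z"

definition coef_set ::
  "'b measure \<Rightarrow> ('b \<Rightarrow> real) \<Rightarrow> 'a measure \<Rightarrow> ('a \<Rightarrow> real ^ 'd) \<Rightarrow> ('a \<Rightarrow> real) \<Rightarrow> (real ^ 'd) set" where
  "coef_set N Y M X \<epsilon> = {\<beta>. eq_in_distr N Y M (\<lambda>\<omega>. \<beta> \<bullet> X \<omega> + \<epsilon> \<omega>)}"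

end

theory Submission
  imports Defs "HOL-Complex_Analysis.Complex_Analysis"
begin

text \<open>
  Write \<open>\<phi>\<close> for the characteristic function of \<open>f\<close>, \<open>b\<^sub>j = \<beta>\<^sub>j / \<lambda>\<^sub>j\<close> and \<open>c\<^sub>j = \<beta>\<^sub>0\<^sub>j / \<lambda>\<^sub>j\<close>.
  Because the characteristic function of \<open>\<epsilon>\<close> has no interval of zeros, \<open>\<beta> \<in> \<B>\<^sub>0\<close> means
  \<open>\<Prod>\<^sub>j \<phi> (b\<^sub>j t) = \<Prod>\<^sub>j \<phi> (c\<^sub>j t)\<close> for all \<open>t\<close>. Taking formal logarithms of the moment series and
  symmetrising, either \<open>\<Sum>\<^sub>j \<bar>b\<^sub>j\<bar>\<^sup>n = \<Sum>\<^sub>j \<bar>c\<^sub>j\<bar>\<^sup>n\<close> or the \<open>n\<close>-th cumulant of \<open>X - X'\<close> vanishes, where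
  \<open>X, X'\<close> are independent with density \<open>f\<close>. If the multisets of the \<open>\<bar>b\<^sub>j\<bar>\<close> and of the \<open>\<bar>c\<^sub>j\<bar>\<close> differ,
  the power sums differ for all large \<open>n\<close>, so the symmetrised moment series is \<open>exp\<close> of a polynomial \<open>Q\<close>.
  Then \<open>X\<close> has exponential moments, its moment generating function \<open>F\<close> is entire with
  \<open>F z * F (- z) = exp (Q z)\<close>, hence has no zeros and \<open>log \<bar>F\<bar>\<close> grows polynomially; by
  Borel--Caratheodory \<open>F\<close> is \<open>exp\<close> of a polynomial, and the ridge inequality \<open>\<bar>F z\<bar> \<le> F (Re z)\<close> forces
  its degree to be at most 2 (Marcinkiewicz), so \<open>f\<close> is Gaussian.
\<close>

section \<open>Asymptotic expansions at zero\<close>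

unbundle no vec_syntax

text \<open>Encoding A(c X) as a composition makes multiplicativity an instance of the laws for
  \<open>oo\<close>.\<close>

definition fps_dilate :: "complex \<Rightarrow> complex fps \<Rightarrow> complex fps" where
  "fps_dilate c A = A oo (fps_const c * fps_X)"

lemma fps_dilate_nth [simp]: "fps_dilate c A $ n = c ^ n * A $ n"
  by (simp add: fps_dilate_def)

lemma fps_dilate_dilate: "fps_dilate a (fps_dilate b A) = fps_dilate (a * b) A"
  by (simp add: fps_eq_iff power_mult_distrib)

lemma fps_dilate_mult: "fps_dilate c (A * B) = fps_dilate c A * fps_dilate c B"
  by (simp add: fps_dilate_def fps_compose_mult_distrib)

lemma fps_dilate_prod: "fps_dilate c (\<Prod>i\<in>I. A i) = (\<Prod>i\<in>I. fps_dilate c (A i))"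
  by (simp add: fps_dilate_def fps_compose_prod_distrib)

lemma fps_deriv_dilate: "fps_deriv (fps_dilate c A) = fps_const c * fps_dilate c (fps_deriv A)"
  by (simp add: fps_eq_iff)

text \<open>An expansion in the sense of Poincare: the series need not converge, since finite
  moments give no positive radius. The filter \<open>nhds 0\<close>, unlike a punctured one,
  survives the substitution t -> b t even when b = 0.\<close>

definition asymp_fps :: "(real \<Rightarrow> complex) \<Rightarrow> complex fps \<Rightarrow> bool" where
  "asymp_fps g A \<longleftrightarrow>
     (\<forall>n. (\<lambda>t. g t - (\<Sum>k<n. A $ k * of_real t ^ k)) \<in> O[nhds 0](\<lambda>t. of_real t ^ n))"

lemma power_bigo_nhds_0:
  fixes m n :: nat
  assumes "n \<le> m"
  shows "(\<lambda>t::real. of_real t ^ m :: complex) \<in> O[nhds 0](\<lambda>t. of_real t ^ n)"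
proof (rule bigoI[where c=1])
  have "eventually (\<lambda>t::real. \<bar>t\<bar> \<le> 1) (nhds 0)"
    using eventually_nhds_metric[of "\<lambda>t::real. \<bar>t\<bar> \<le> 1" 0] by (auto intro: exI[of _ 1])
  then show "\<forall>\<^sub>F t in nhds 0. norm (of_real t ^ m :: complex) \<le> 1 * norm (of_real t ^ n :: complex)"
    by eventually_elim (use assms in \<open>auto simp: norm_power intro: power_decreasing\<close>)
qed

lemma monomial_bigo_nhds_0:
  fixes m n :: nat and c :: complex
  assumes "n \<le> m"
  shows "(\<lambda>t::real. c * of_real t ^ m) \<in> O[nhds 0](\<lambda>t. of_real t ^ n)"
  using power_bigo_nhds_0[OF assms] by (cases "c = 0") simp_all

lemma asymp_fps_1: "asymp_fps (\<lambda>_. 1) 1"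
  unfolding asymp_fps_def
proof
  fix n
  show "(\<lambda>t::real. 1 - (\<Sum>k<n. (1::complex fps) $ k * of_real t ^ k)) \<in> O[nhds 0](\<lambda>t. of_real t ^ n)"
    by (cases n) (auto simp: sum.lessThan_Suc_shift simp del: sum.lessThan_Suc)
qed

lemma asymp_fps_dilate:
  assumes "asymp_fps g A"
  shows "asymp_fps (\<lambda>t. g (b * t)) (fps_dilate (of_real b) A)"
  unfolding asymp_fps_def
proof
  fix n
  have lim: "filterlim (\<lambda>t. b * t) (nhds 0) (nhds (0::real))"
    using tendsto_mult[OF tendsto_const[of b "nhds 0"] filterlim_ident[of "nhds (0::real)"]] by simp
  have "(\<lambda>t. g t - (\<Sum>k<n. A $ k * of_real t ^ k)) \<in> O[nhds 0](\<lambda>t. of_real t ^ n)"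
    using assms unfolding asymp_fps_def by blast
  from landau_o.big.compose[OF this lim]
  have "(\<lambda>t. g (b * t) - (\<Sum>k<n. A $ k * of_real (b * t) ^ k)) \<in> O[nhds 0](\<lambda>t. of_real (b * t) ^ n)" .
  also have "(\<lambda>t. of_real (b * t) ^ n :: complex) \<in> O[nhds 0](\<lambda>t. of_real t ^ n)"
    by (intro bigoI[where c="\<bar>b\<bar> ^ n"]) (auto simp: norm_power norm_mult power_mult_distrib abs_mult)
  finally show "(\<lambda>t. g (b * t) - (\<Sum>k<n. fps_dilate (of_real b) A $ k * of_real t ^ k))
      \<in> O[nhds 0](\<lambda>t. of_real t ^ n)"
    by (simp add: fps_dilate_nth power_mult_distrib mult_ac)
qed

text \<open>With truncations G and H, g h - G H = g (h - H) + (g - G) H. Since g and H are bounded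
  near 0, both terms are O(t^n).\<close>

lemma asymp_fps_mult:
  assumes "asymp_fps g A" "asymp_fps h B"
  shows "asymp_fps (\<lambda>t. g t * h t) (A * B)"
  unfolding asymp_fps_def
proof
  fix n
  define G where "G t = (\<Sum>k<n. A $ k * of_real t ^ k)" for t :: real
  define H where "H t = (\<Sum>k<n. B $ k * of_real t ^ k)" for t :: real
  define S where "S = {..<n} \<times> {..<n}"
  have finS: "finite S" by (simp add: S_def)
  let ?F = "nhds (0::real)"
  have g: "(\<lambda>t. g t - G t) \<in> O[?F](\<lambda>t. of_real t ^ n)"
    and h: "(\<lambda>t. h t - H t) \<in> O[?F](\<lambda>t. of_real t ^ n)"
    using assms unfolding asymp_fps_def G_def H_def by blast+
  have poly1: "(\<lambda>t. \<Sum>k<n. C $ k * of_real t ^ k) \<in> O[?F](\<lambda>_. 1)" for C :: "complex fps"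
    using monomial_bigo_nhds_0[of 0] by (intro big_sum_in_bigo) auto
  have g1: "g \<in> O[?F](\<lambda>_. 1)"
  proof -
    have "(\<lambda>t. (g t - G t) + G t) \<in> O[?F](\<lambda>_. 1)"
      by (intro sum_in_bigo landau_o.big_trans[OF g]) (use poly1 power_bigo_nhds_0[of 0 n] in \<open>auto simp: G_def\<close>)
    then show ?thesis by simp
  qed
  \<comment> \<open>Multiplying the truncations creates the coefficients of \<open>A * B\<close>
    below n, plus monomials of degree at least n.\<close>
  have eq: "G t * H t - (\<Sum>k<n. (A * B) $ k * of_real t ^ k) =
      (\<Sum>(i,j)\<in>{(i,j)\<in>S. n \<le> i + j}. A $ i * B $ j * of_real t ^ (i + j))" for t
  proof -
    have "G t * H t = (\<Sum>(i,j)\<in>S. A $ i * B $ j * of_real t ^ (i + j))"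
      unfolding G_def H_def S_def sum_product sum.cartesian_product
      by (simp add: power_add mult_ac case_prod_beta)
    also have "S = {(i,j)\<in>S. n \<le> i + j} \<union> {(i,j)\<in>S. i + j < n}"
      by auto
    also have "(\<Sum>(i,j)\<in>\<dots>. A $ i * B $ j * of_real t ^ (i + j)) =
        (\<Sum>(i,j)\<in>{(i,j)\<in>S. n \<le> i + j}. A $ i * B $ j * of_real t ^ (i + j)) +
        (\<Sum>(i,j)\<in>{(i,j)\<in>S. i + j < n}. A $ i * B $ j * of_real t ^ (i + j))"
      by (rule sum.union_disjoint) (auto intro: finite_subset[OF _ finS])
    also have "(\<Sum>(i,j)\<in>{(i,j)\<in>S. i + j < n}. A $ i * B $ j * of_real t ^ (i + j)) =
        (\<Sum>(k,i)\<in>(SIGMA k:{..<n}. {0..k}). A $ i * B $ (k - i) * of_real t ^ k)"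
      by (rule sum.reindex_bij_witness[where i="\<lambda>(k,i). (i, k - i)" and j="\<lambda>(i,j). (i + j, i)"])
         (auto simp: S_def)
    also have "\<dots> = (\<Sum>k<n. (A * B) $ k * of_real t ^ k)"
      by (subst sum.Sigma[symmetric]) (auto simp: fps_mult_nth sum_distrib_right)
    finally show ?thesis by simp
  qed
  have "(\<lambda>t. G t * H t - (\<Sum>k<n. (A * B) $ k * of_real t ^ k)) \<in> O[?F](\<lambda>t. of_real t ^ n)"
    unfolding eq case_prod_beta by (intro big_sum_in_bigo monomial_bigo_nhds_0) auto
  moreover have "(\<lambda>t. g t * (h t - H t)) \<in> O[?F](\<lambda>t. 1 * of_real t ^ n)"
    by (rule landau_o.big.mult[OF g1 h])
  moreover have "(\<lambda>t. (g t - G t) * H t) \<in> O[?F](\<lambda>t. of_real t ^ n * 1)"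
    using poly1[of B] by (intro landau_o.big.mult[OF g]) (auto simp: H_def)
  ultimately have "(\<lambda>t. g t * (h t - H t) + (g t - G t) * H t +
      (G t * H t - (\<Sum>k<n. (A * B) $ k * of_real t ^ k))) \<in> O[?F](\<lambda>t. of_real t ^ n)"
    by (intro sum_in_bigo(1)) auto
  then show "(\<lambda>t. g t * h t - (\<Sum>k<n. (A * B) $ k * of_real t ^ k)) \<in> O[?F](\<lambda>t. of_real t ^ n)"
    by (simp add: algebra_simps)
qed

lemma asymp_fps_prod:
  assumes "\<And>i. i \<in> I \<Longrightarrow> asymp_fps (g i) (A i)"
  shows "asymp_fps (\<lambda>t. \<Prod>i\<in>I. g i t) (\<Prod>i\<in>I. A i)"
  using assms by (induction I rule: infinite_finite_induct) (auto intro: asymp_fps_1 asymp_fps_mult)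

text \<open>At the first index m where the series differ, subtracting the expansions leaves a
  nonzero multiple of t^m that is O(t^(m+1)), which is impossible as t tends to 0 from the
  right.\<close>

lemma asymp_fps_unique:
  assumes "asymp_fps g A" "asymp_fps g B"
  shows "A = B"
proof (rule ccontr)
  assume "A \<noteq> B"
  define D where "D = A - B"
  define m where "m = subdegree D"
  have Dm: "D $ m \<noteq> 0" using \<open>A \<noteq> B\<close> unfolding m_def by (intro nth_subdegree_nonzero) (simp add: D_def)
  have "(\<lambda>t. (g t - (\<Sum>k<Suc m. B $ k * of_real t ^ k)) - (g t - (\<Sum>k<Suc m. A $ k * of_real t ^ k)))
      \<in> O[nhds 0](\<lambda>t. of_real t ^ Suc m)"
    by (rule sum_in_bigo(2)) (use assms in \<open>unfold asymp_fps_def, blast+\<close>)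
  moreover have "(\<lambda>t. (g t - (\<Sum>k<Suc m. B $ k * of_real t ^ k)) - (g t - (\<Sum>k<Suc m. A $ k * of_real t ^ k))) =
      (\<lambda>t. D $ m * of_real t ^ m)"
  proof
    fix t :: real
    have AB: "A $ k = B $ k" if "k < m" for k
      using nth_less_subdegree_zero[of k D] that by (simp add: m_def D_def)
    have "(\<Sum>k<m. A $ k * of_real t ^ k) = (\<Sum>k<m. B $ k * of_real t ^ k)"
      by (intro sum.cong refl) (simp only: AB lessThan_iff)
    then show "(g t - (\<Sum>k<Suc m. B $ k * of_real t ^ k)) - (g t - (\<Sum>k<Suc m. A $ k * of_real t ^ k)) = D $ m * of_real t ^ m"
      by (simp add: D_def left_diff_distrib)
  qed
  ultimately have "(\<lambda>t::real. D $ m * of_real t ^ m) \<in> O[nhds 0](\<lambda>t. of_real t ^ Suc m)"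
    by (simp only:)
  then obtain c where "\<forall>\<^sub>F t in nhds 0. norm (D $ m * of_real t ^ m) \<le> c * norm (of_real t ^ Suc m :: complex)"
    by (rule landau_o.bigE)
  then have "\<forall>\<^sub>F t in at_right 0. norm (D $ m) * \<bar>t\<bar> ^ m \<le> c * (\<bar>t\<bar> * \<bar>t\<bar> ^ m)"
    using filter_leD[OF at_within_le_nhds] by (simp add: norm_mult norm_power)
  moreover have "\<forall>\<^sub>F t in at_right 0. (t::real) > 0"
    by (simp add: eventually_at_right_less)
  ultimately have "\<forall>\<^sub>F t in at_right 0. norm (D $ m) \<le> c * t"
    by eventually_elim simp
  moreover have "((\<lambda>t. c * t) \<longlongrightarrow> c * 0) (at_right 0)"
    by (intro tendsto_intros)
  ultimately have "norm (D $ m) \<le> c * 0"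
    by (intro tendsto_lowerbound[of "\<lambda>t. c * t" _ "at_right 0"]) auto
  then show False using Dm by simp
qed

section \<open>Power sums and the symmetrised moment series\<close>

text \<open>Logarithmic derivatives turn products into sums without any formal logarithm. Constant
  term 1 makes each \<open>A i\<close> invertible, hence the division exact.\<close>

lemma fps_log_deriv_prod:
  fixes A :: "'i \<Rightarrow> complex fps"
  assumes "finite I" "\<And>i. i \<in> I \<Longrightarrow> A i $ 0 = 1"
  shows "fps_deriv (\<Prod>i\<in>I. A i) = (\<Prod>i\<in>I. A i) * (\<Sum>i\<in>I. fps_deriv (A i) / A i)"
  using assms
proof (induction I rule: finite_induct)
  case (insert x F)
  have "fps_deriv (A x) = A x * (fps_deriv (A x) / A x)"
    using insert.prems[of x] by (intro dvd_mult_div_cancel[symmetric] fps_unit_dvd) simp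
  then show ?case
    using insert by (simp add: algebra_simps)
qed simp

lemma fps_dilate_nonzero: "A $ 0 \<noteq> 0 \<Longrightarrow> fps_dilate c A \<noteq> 0"
  by (metis fps_dilate_nth fps_zero_nth mult_1_left power_0)

lemma fps_dilate_log_deriv:
  fixes A :: "complex fps"
  assumes "A $ 0 = 1"
  shows "fps_deriv (fps_dilate b A) / fps_dilate b A = fps_const b * fps_dilate b (fps_deriv A / A)"
proof -
  have "fps_dilate b A * (fps_const b * fps_dilate b (fps_deriv A / A)) = fps_const b * fps_dilate b (A * (fps_deriv A / A))"
    by (simp add: fps_dilate_mult mult_ac)
  also have "A * (fps_deriv A / A) = fps_deriv A"
    using assms by (intro dvd_mult_div_cancel fps_unit_dvd) simp
  also have "fps_const b * fps_dilate b (fps_deriv A) = fps_deriv (fps_dilate b A)"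
    by (simp add: fps_deriv_dilate)
  finally have eq: "fps_deriv (fps_dilate b A) = fps_dilate b A * (fps_const b * fps_dilate b (fps_deriv A / A))" ..
  have "fps_dilate b A \<noteq> 0" using assms by (simp add: fps_dilate_nonzero)
  then show ?thesis unfolding eq by simp
qed

text \<open>Coefficient n of the logarithmic derivative is (n + 1) times coefficient n + 1 of the
  logarithm, hence the exponent \<open>Suc n\<close>. For a moment series it is the cumulant of
  order n + 1 divided by n!. The factor stays on both sides because it may vanish.\<close>

lemma fps_prod_dilate_eq_imp_power_sum:
  fixes A :: "complex fps" and b c :: "'i \<Rightarrow> complex"
  assumes "finite I" "A $ 0 = 1"
    and "(\<Prod>i\<in>I. fps_dilate (b i) A) = (\<Prod>i\<in>I. fps_dilate (c i) A)"
  shows "(fps_deriv A / A) $ n * (\<Sum>i\<in>I. b i ^ Suc n) = (fps_deriv A / A) $ n * (\<Sum>i\<in>I. c i ^ Suc n)"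
proof -
  let ?L = "fps_deriv A / A"
  have nz: "(\<Prod>i\<in>I. fps_dilate (c i) A) \<noteq> 0"
    using assms(1,2) by (subst prod_zero_iff) (auto simp: fps_dilate_nonzero)
  have deriv: "fps_deriv (\<Prod>i\<in>I. fps_dilate (a i) A) =
      (\<Prod>i\<in>I. fps_dilate (a i) A) * (\<Sum>i\<in>I. fps_const (a i) * fps_dilate (a i) ?L)" for a
    using assms(1,2) by (subst fps_log_deriv_prod) (auto simp: fps_dilate_log_deriv)
  have "(\<Prod>i\<in>I. fps_dilate (c i) A) * (\<Sum>i\<in>I. fps_const (b i) * fps_dilate (b i) ?L) =
      (\<Prod>i\<in>I. fps_dilate (c i) A) * (\<Sum>i\<in>I. fps_const (c i) * fps_dilate (c i) ?L)"
    using deriv[of b] deriv[of c] unfolding assms(3) by metis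
  then have "(\<Sum>i\<in>I. fps_const (b i) * fps_dilate (b i) ?L) $ n = (\<Sum>i\<in>I. fps_const (c i) * fps_dilate (c i) ?L) $ n"
    using nz by simp
  then show ?thesis
    by (simp add: fps_sum_nth sum_distrib_left mult_ac)
qed

section \<open>Power sums of multisets of nonnegative reals\<close>

lemma count_image_mset_mset_set:
  assumes "finite I"
  shows "count (image_mset f (mset_set I)) v = card {i\<in>I. f i = v}"
  using assms
proof (induction I rule: finite_induct)
  case (insert x F)
  have "{i \<in> insert x F. f i = v} = (if f x = v then insert x {i\<in>F. f i = v} else {i\<in>F. f i = v})"
    by auto
  then show ?case using insert by simp
qed simp

text \<open>The difference of the power sums is a combination of the v^n weighted by differences of
  multiplicities; the largest v of nonzero weight dominates for large n.\<close>

lemma power_sums_eventually_neq: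
  fixes b c :: "'i \<Rightarrow> real"
  assumes "finite I" "\<And>i. i \<in> I \<Longrightarrow> b i \<ge> 0" "\<And>i. i \<in> I \<Longrightarrow> c i \<ge> 0"
    and "image_mset b (mset_set I) \<noteq> image_mset c (mset_set I)"
  shows "\<forall>\<^sub>F n in sequentially. (\<Sum>i\<in>I. b i ^ n) \<noteq> (\<Sum>i\<in>I. c i ^ n)"
proof -
  define S where "S = b ` I \<union> c ` I"
  define d where "d v = real (card {i\<in>I. b i = v}) - real (card {i\<in>I. c i = v})" for v
  have S: "finite S" "\<And>v. v \<in> S \<Longrightarrow> v \<ge> 0" using assms unfolding S_def by auto
  have psum: "(\<Sum>i\<in>I. b i ^ n) - (\<Sum>i\<in>I. c i ^ n) = (\<Sum>v\<in>S. d v * v ^ n)" for n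
  proof -
    have "(\<Sum>i\<in>I. g i ^ n) = (\<Sum>v\<in>S. real (card {i\<in>I. g i = v}) * v ^ n)" if "g ` I \<subseteq> S" for g :: "'i \<Rightarrow> real"
    proof -
      have "(\<Sum>i\<in>I. g i ^ n) = (\<Sum>v\<in>S. \<Sum>i | i \<in> I \<and> g i = v. g i ^ n)"
        by (rule sum.group[symmetric]) (use that S assms in auto)
      then show ?thesis by simp
    qed
    from this[of b] this[of c] show ?thesis
      by (simp add: S_def d_def sum_subtractf algebra_simps)
  qed
  define T where "T = {v\<in>S. d v \<noteq> 0}"
  have "T \<noteq> {}"
  proof
    assume "T = {}"
    have "count (image_mset b (mset_set I)) v = count (image_mset c (mset_set I)) v" for v
    proof -
      have "d v = 0"
      proof (cases "v \<in> S")
        case False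
        then have e: "{i\<in>I. b i = v} = {}" "{i\<in>I. c i = v} = {}" by (auto simp: S_def)
        show ?thesis unfolding d_def e by simp
      qed (use \<open>T = {}\<close> in \<open>auto simp: T_def\<close>)
      then show ?thesis
        unfolding count_image_mset_mset_set[OF assms(1)] by (simp add: d_def)
    qed
    then show False using assms(4) by (auto simp: multiset_eq_iff)
  qed
  define x where "x = Max T"
  have finT: "finite T" using S by (simp add: T_def)
  have xT: "x \<in> T" using Max_in[OF finT \<open>T \<noteq> {}\<close>] by (simp add: x_def)
  \<comment> \<open>If only v = 0 carried weight, the power sums for n = 0 (with 0^0 = 1) would
    differ, yet both equal the size of I.\<close>
  have "x > 0"
  proof (rule ccontr)
    assume "\<not> x > 0"
    have "v = 0" if "v \<in> T" for v
      using Max_ge[OF finT that] S(2)[of v] that \<open>\<not> x > 0\<close> by (auto simp: x_def T_def)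
    then have "T \<subseteq> {0}" by auto
    then have "T = {0}" using xT by auto
    have "(\<Sum>v\<in>S. d v * v ^ 0) = (\<Sum>v\<in>T. d v)"
      using S by (intro sum.mono_neutral_cong_right) (auto simp: T_def)
    with psum[of 0] \<open>T = {0}\<close> have "d 0 = 0" by simp
    then show False using \<open>T = {0}\<close> by (auto simp: T_def)
  qed
  have "(\<lambda>n. d v * (v / x) ^ n) \<longlonglongrightarrow> (if v = x then d x else 0)" if "v \<in> S" for v
  proof (cases "v < x")
    case True
    then have "\<bar>v / x\<bar> < 1" using S(2)[OF that] \<open>x > 0\<close> by (simp add: divide_less_eq)
    then have "(\<lambda>n. d v * (v / x) ^ n) \<longlonglongrightarrow> d v * 0"
      by (intro tendsto_intros) (simp add: LIMSEQ_power_zero)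
    then show ?thesis using True by simp
  next
    case False
    show ?thesis
    proof (cases "v = x")
      case neq: False
      then have "v \<notin> T" using Max_ge[OF finT, of v] False by (auto simp: x_def)
      then show ?thesis using that neq by (simp add: T_def)
    qed (use \<open>x > 0\<close> in simp)
  qed
  then have "(\<lambda>n. \<Sum>v\<in>S. d v * (v / x) ^ n) \<longlonglongrightarrow> (\<Sum>v\<in>S. if v = x then d x else 0)"
    by (intro tendsto_sum) auto
  also have "(\<Sum>v\<in>S. if v = x then d x else 0) = d x" using xT S(1) by (simp add: T_def)
  finally have "\<forall>\<^sub>F n in sequentially. (\<Sum>v\<in>S. d v * (v / x) ^ n) \<noteq> 0"
    using xT by (intro tendsto_imp_eventually_ne) (auto simp: T_def)
  then show ?thesis
  proof eventually_elim
    case (elim n)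
    have "(\<Sum>v\<in>S. d v * (v / x) ^ n) = (\<Sum>v\<in>S. d v * v ^ n) / x ^ n"
      by (simp add: sum_divide_distrib power_divide)
    with elim psum[of n] show ?case by auto
  qed
qed

section \<open>Series whose logarithm is a polynomial\<close>

lemma fps_linear_ode_unique:
  fixes A B L :: "complex fps"
  assumes "fps_deriv A = L * A" "fps_deriv B = L * B" "A $ 0 = B $ 0"
  shows "A = B"
proof (rule fps_ext)
  fix n show "A $ n = B $ n"
  proof (induction n rule: less_induct)
    case (less n)
    show ?case
    proof (cases n)
      case (Suc m)
      have "of_nat (Suc m) * A $ Suc m = (\<Sum>i=0..m. L $ i * A $ (m - i))"
        using arg_cong[OF assms(1), of "\<lambda>F. F $ m"] by (simp add: fps_mult_nth)
      also have "\<dots> = (\<Sum>i=0..m. L $ i * B $ (m - i))"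
        using less Suc by (intro sum.cong) auto
      also have "\<dots> = of_nat (Suc m) * B $ Suc m"
        using arg_cong[OF assms(2), of "\<lambda>F. F $ m"] by (simp add: fps_mult_nth)
      finally show ?thesis using Suc by (simp del: of_nat_Suc)
    qed (use assms in simp)
  qed
qed

text \<open>Q is an antiderivative of the polynomial A' / A, and both exp(Q) and A solve Y' = (A' /
  A) Y with constant term 1.\<close>

lemma has_fps_expansion_exp_poly_of_log_deriv:
  fixes A :: "complex fps"
  assumes "A $ 0 = 1" "\<And>n. n \<ge> N \<Longrightarrow> (fps_deriv A / A) $ n = 0"
  shows "\<exists>Q. (\<lambda>z. exp (poly Q z)) has_fps_expansion A"
proof -
  let ?L = "fps_deriv A / A"
  \<comment> \<open>The index shift comes from integration. The value q 0 = 0 permits the formal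
    composition with the exponential and gives constant term 1.\<close>
  define q where "q n = (if n = 0 \<or> n > N then 0 else ?L $ (n - 1) / of_nat n)" for n
  define Q where "Q = Abs_poly q"
  have "\<forall>\<^sub>\<infinity>n. q n = 0"
    unfolding MOST_nat by (rule exI[of _ N]) (simp add: q_def)
  then have coeff: "coeff Q = q"
    by (simp add: Q_def Abs_poly_inverse)
  define E where "E = fps_exp 1 oo fps_of_poly Q"
  have "(\<lambda>z. eval_fps (fps_of_poly Q) z) has_fps_expansion fps_of_poly Q"
    by (intro eval_fps_has_fps_expansion) simp
  then have Qexp: "poly Q has_fps_expansion fps_of_poly Q"
    by simp
  have Q0: "fps_of_poly Q $ 0 = 0" by (simp add: coeff q_def)
  have "(exp \<circ> poly Q) has_fps_expansion E"
    unfolding E_def by (rule has_fps_expansion_compose[OF has_fps_expansion_exp1 Qexp Q0])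
  moreover have "E = A"
  proof (rule fps_linear_ode_unique)
    show "fps_deriv A = ?L * A"
      using assms(1) by (subst mult.commute, intro dvd_mult_div_cancel[symmetric] fps_unit_dvd) simp
    have "fps_deriv (fps_of_poly Q) = ?L"
      using assms(2) by (auto simp: fps_eq_iff coeff q_def simp del: of_nat_Suc)
    then show "fps_deriv E = ?L * E"
      unfolding E_def using Q0 by (subst fps_compose_deriv) (auto simp: mult.commute)
    show "E $ 0 = A $ 0" using assms(1) by (simp add: E_def)
  qed
  ultimately show ?thesis by (auto simp: comp_def)
qed

section \<open>Formal moment series of a law and its symmetrisation\<close>

definition moment_fps :: "real measure \<Rightarrow> complex fps" where
  "moment_fps M = Abs_fps (\<lambda>k. of_real ((LINT x|M. x ^ k) / fact k))"

text \<open>The moment series of \<open>X - X'\<close> for independent copies \<open>X\<close>, \<open>X'\<close>; it is even, so only absolute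
  values of scale factors matter.\<close>

definition sym_moment_fps :: "real measure \<Rightarrow> complex fps" where
  "sym_moment_fps M = moment_fps M * fps_dilate (-1) (moment_fps M)"

context real_distribution
begin

text \<open>Formally, the characteristic function at t is the moment generating function at \<i> t,
  hence the dilation by \<i>.\<close>

lemma asymp_fps_char:
  assumes "\<And>k. integrable M (\<lambda>x. x ^ k)"
  shows "asymp_fps (char M) (fps_dilate \<i> (moment_fps M))"
  unfolding asymp_fps_def
proof
  fix n
  let ?A = "fps_dilate \<i> (moment_fps M)"
  have eq: "?A $ k * of_real t ^ k = (\<i> * t) ^ k / fact k * expectation (\<lambda>x. x ^ k)" for k t
    by (simp add: moment_fps_def power_mult_distrib)
  have "(\<lambda>t. char M t - (\<Sum>k\<le>n. ?A $ k * of_real t ^ k)) \<in> O[nhds 0](\<lambda>t. of_real t ^ n)"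
    unfolding eq
    by (rule bigoI[where c="2 / fact n * expectation (\<lambda>x. \<bar>x\<bar> ^ n)"])
       (use char_approx1[of n] assms in \<open>auto simp: norm_power mult_ac intro!: always_eventually\<close>)
  \<comment> \<open>\<open>char_approx1\<close> sums up to k = n, but \<open>asymp_fps\<close> stops
    before n; the surplus monomial is itself O(t^n).\<close>
  moreover have "(\<lambda>t. ?A $ n * of_real t ^ n) \<in> O[nhds 0](\<lambda>t. of_real t ^ n)"
    by simp
  ultimately have "(\<lambda>t. char M t - (\<Sum>k\<le>n. ?A $ k * of_real t ^ k) + ?A $ n * of_real t ^ n)
      \<in> O[nhds 0](\<lambda>t. of_real t ^ n)"
    by (rule sum_in_bigo)
  then show "(\<lambda>t. char M t - (\<Sum>k<n. ?A $ k * of_real t ^ k)) \<in> O[nhds 0](\<lambda>t. of_real t ^ n)"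
    by (simp add: lessThan_Suc_atMost[symmetric] del: fps_dilate_nth)
qed

lemma moment_fps_prod_dilate_eq:
  assumes "\<And>k. integrable M (\<lambda>x. x ^ k)"
    and "\<And>t. (\<Prod>i\<in>I. char M (b i * t)) = (\<Prod>i\<in>I. char M (c i * t))"
  shows "(\<Prod>i\<in>I. fps_dilate (of_real (b i)) (moment_fps M)) = (\<Prod>i\<in>I. fps_dilate (of_real (c i)) (moment_fps M))"
proof -
  have *: "asymp_fps (\<lambda>t. \<Prod>i\<in>I. char M (b i * t)) (\<Prod>i\<in>I. fps_dilate (of_real (b i)) (fps_dilate \<i> (moment_fps M)))" for b
    by (intro asymp_fps_prod asymp_fps_dilate asymp_fps_char assms)
  have "(\<Prod>i\<in>I. fps_dilate (of_real (b i)) (fps_dilate \<i> (moment_fps M))) =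
      (\<Prod>i\<in>I. fps_dilate (of_real (c i)) (fps_dilate \<i> (moment_fps M)))"
    by (rule asymp_fps_unique[OF *]) (use *[of c] assms(2) in simp)
  from arg_cong[OF this, of "fps_dilate (- \<i>)"] show ?thesis
    by (simp add: fps_dilate_prod fps_dilate_dilate algebra_simps)
qed

lemma moment_fps_nth_0: "moment_fps M $ 0 = 1"
  using prob_space by (simp add: moment_fps_def)

lemma sym_moment_fps_nth_0: "sym_moment_fps M $ 0 = 1"
  by (simp add: sym_moment_fps_def moment_fps_nth_0)

lemma sym_moment_fps_even: "fps_dilate (-1) (sym_moment_fps M) = sym_moment_fps M"
proof -
  have "fps_dilate 1 A = A" for A by (simp add: fps_eq_iff)
  then show ?thesis
    by (simp add: sym_moment_fps_def fps_dilate_mult fps_dilate_dilate mult.commute)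
qed

text \<open>For odd exponents the first alternative holds, since the symmetrised series is even; for
  even exponents the absolute values change nothing.\<close>

lemma sym_moment_fps_power_sums:
  assumes "finite I" "\<And>k. integrable M (\<lambda>x. x ^ k)"
    and "\<And>t. (\<Prod>i\<in>I. char M (b i * t)) = (\<Prod>i\<in>I. char M (c i * t))"
  shows "(fps_deriv (sym_moment_fps M) / sym_moment_fps M) $ n = 0 \<or>
    (\<Sum>i\<in>I. \<bar>b i\<bar> ^ Suc n) = (\<Sum>i\<in>I. \<bar>c i\<bar> ^ Suc n)"
proof -
  let ?S = "sym_moment_fps M"
  let ?L = "fps_deriv ?S / ?S"
  note eq = moment_fps_prod_dilate_eq[OF assms(2,3)]
  have "(\<Prod>i\<in>I. fps_dilate (of_real (b i)) ?S) = (\<Prod>i\<in>I. fps_dilate (of_real (c i)) ?S)"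
    using arg_cong2[OF eq arg_cong[OF eq, of "fps_dilate (-1)"], of "(*)"]
    by (simp add: sym_moment_fps_def fps_dilate_mult fps_dilate_prod fps_dilate_dilate prod.distrib
        del: mult_cancel_left mult_cancel_right)
  from fps_prod_dilate_eq_imp_power_sum[OF assms(1) sym_moment_fps_nth_0 this, of n]
  have "?L $ n = 0 \<or> of_real (\<Sum>i\<in>I. b i ^ Suc n) = (of_real (\<Sum>i\<in>I. c i ^ Suc n) :: complex)"
    by auto
  then have 1: "?L $ n = 0 \<or> (\<Sum>i\<in>I. b i ^ Suc n) = (\<Sum>i\<in>I. c i ^ Suc n)"
    unfolding of_real_eq_iff .
  show ?thesis
  proof (cases "even n")
    case True
    have "?L = fps_const (-1) * fps_dilate (-1) ?L"
      using fps_dilate_log_deriv[OF sym_moment_fps_nth_0, of "-1"] unfolding sym_moment_fps_even .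
    then have "?L $ n = - ((-1) ^ n * ?L $ n)"
      by (metis fps_dilate_nth fps_mult_left_const_nth mult_minus1)
    then show ?thesis using True by simp
  next
    case False
    then have "\<bar>x\<bar> ^ Suc n = x ^ Suc n" for x :: real by (intro power_even_abs) auto
    then show ?thesis using 1 by simp
  qed
qed

lemma sym_moment_fps_exp_poly:
  assumes "finite I" "\<And>k. integrable M (\<lambda>x. x ^ k)"
    and "\<And>t. (\<Prod>i\<in>I. char M (b i * t)) = (\<Prod>i\<in>I. char M (c i * t))"
    and "image_mset (\<lambda>i. \<bar>b i\<bar>) (mset_set I) \<noteq> image_mset (\<lambda>i. \<bar>c i\<bar>) (mset_set I)"
  shows "\<exists>Q. (\<lambda>z. exp (poly Q z)) has_fps_expansion sym_moment_fps M"
proof -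
  have "\<forall>\<^sub>F n in sequentially. (\<Sum>i\<in>I. \<bar>b i\<bar> ^ n) \<noteq> (\<Sum>i\<in>I. \<bar>c i\<bar> ^ n)"
    by (rule power_sums_eventually_neq[OF assms(1) _ _ assms(4)]) auto
  then obtain N where N: "\<And>n. n \<ge> N \<Longrightarrow> (\<Sum>i\<in>I. \<bar>b i\<bar> ^ n) \<noteq> (\<Sum>i\<in>I. \<bar>c i\<bar> ^ n)"
    unfolding eventually_sequentially by blast
  show ?thesis
  proof (rule has_fps_expansion_exp_poly_of_log_deriv[OF sym_moment_fps_nth_0])
    fix n assume "n \<ge> N"
    then show "(fps_deriv (sym_moment_fps M) / sym_moment_fps M) $ n = 0"
      using sym_moment_fps_power_sums[OF assms(1-3), of n] N[of "Suc n"] by auto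
  qed
qed

end

section \<open>Exponential moments\<close>

text \<open>The integrand is bounded on the imaginary axis. Elsewhere it may fail to be integrable,
  and then the integral is 0 by convention, so analytic properties are derived under exponential
  moments.\<close>

definition mgf :: "real measure \<Rightarrow> complex \<Rightarrow> complex" where
  "mgf M z = (CLINT x|M. exp (z * of_real x))"

lemma char_eq_mgf: "char M t = mgf M (\<i> * of_real t)"
  by (simp add: char_def mgf_def mult.assoc)

context real_distribution
begin

text \<open>Binomial expansion separates x and y. The iterated integral, rather than a product
  measure, suits Jensen's inequality in y for fixed x.\<close>

lemma sym_moment_fps_nth:
  assumes "\<And>k. integrable M (\<lambda>x. x ^ k)"
  shows "fact n * sym_moment_fps M $ n = of_real (LINT x|M. LINT y|M. (x - y) ^ n)"
    and "integrable M (\<lambda>x. LINT y|M. (x - y) ^ n)"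
proof -
  define m where "m k = (LINT x|M. x ^ k)" for k :: nat
  have inner: "(LINT y|M. (x - y) ^ n) = (\<Sum>k\<le>n. of_nat (n choose k) * x ^ k * ((-1) ^ (n - k) * m (n - k)))" for x
  proof -
    have "(x - y) ^ n = (\<Sum>k\<le>n. of_nat (n choose k) * x ^ k * ((-1) ^ (n - k) * y ^ (n - k)))" for y
      using binomial_ring[of x "- y" n] by (simp add: power_minus[of y])
    then have "(LINT y|M. (x - y) ^ n) =
        (LINT y|M. (\<Sum>k\<le>n. of_nat (n choose k) * x ^ k * ((-1) ^ (n - k) * y ^ (n - k))))"
      by simp
    also have "\<dots> = (\<Sum>k\<le>n. LINT y|M. of_nat (n choose k) * x ^ k * ((-1) ^ (n - k) * y ^ (n - k)))"
      by (intro Bochner_Integration.integral_sum integrable_mult_right assms)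
    finally show ?thesis by (simp add: m_def)
  qed
  show "integrable M (\<lambda>x. LINT y|M. (x - y) ^ n)"
    unfolding inner by (intro Bochner_Integration.integrable_sum integrable_mult_right integrable_mult_left assms)
  have "(LINT x|M. LINT y|M. (x - y) ^ n) = (\<Sum>k\<le>n. LINT x|M. of_nat (n choose k) * x ^ k * ((-1) ^ (n - k) * m (n - k)))"
    unfolding inner
    by (intro Bochner_Integration.integral_sum integrable_mult_right integrable_mult_left assms)
  also have "\<dots> = (\<Sum>k\<le>n. of_nat (n choose k) * m k * ((-1) ^ (n - k) * m (n - k)))"
    by (simp add: m_def)
  also have "of_real \<dots> = fact n * sym_moment_fps M $ n"
    by (simp add: sym_moment_fps_def fps_mult_nth moment_fps_def sum_distrib_left binomial_fact
        atLeast0AtMost m_def[symmetric] mult_ac)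
  finally show "fact n * sym_moment_fps M $ n = of_real (LINT x|M. LINT y|M. (x - y) ^ n)" ..
qed

lemma integrable_power_diff:
  assumes "\<And>k. integrable M (\<lambda>x. x ^ k)"
  shows "integrable M (\<lambda>x. (x - c) ^ n :: real)"
proof -
  have "(x - c) ^ n = (\<Sum>k\<le>n. of_nat (n choose k) * x ^ k * (- c) ^ (n - k))" for x
    using binomial_ring[of x "- c" n] by simp
  then show ?thesis
    by (simp only:) (intro Bochner_Integration.integrable_sum integrable_mult_right integrable_mult_left assms)
qed

text \<open>By Jensen's inequality, averaging over an independent copy only increases even central moments.\<close>

lemma central_moment_le:
  assumes "\<And>k. integrable M (\<lambda>x. x ^ k)" "even n"
  shows "(LINT x|M. (x - expectation (\<lambda>x. x)) ^ n) / fact n \<le> cmod (sym_moment_fps M $ n)"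
proof -
  let ?m = "expectation (\<lambda>x. x)"
  have int1: "integrable M (\<lambda>x. x)" using assms(1)[of 1] by simp
  have "(x - ?m) ^ n \<le> (LINT y|M. (x - y) ^ n)" for x
  proof -
    have "(expectation (\<lambda>y. x - y)) ^ n \<le> (LINT y|M. (x - y) ^ n)"
    proof (rule jensens_inequality[where I=UNIV and q="\<lambda>u. u ^ n"])
      have "(x - y) ^ n = (y - x) ^ n" for y using assms(2) by (metis minus_diff_eq power_minus_even)
      then show "integrable M (\<lambda>y. (x - y) ^ n)"
        using integrable_power_diff[OF assms(1), of x n] by simp
    qed (use int1 assms(2) in \<open>auto intro: convex_power_even\<close>)
    also have "expectation (\<lambda>y. x - y) = x - ?m"
      using int1 prob_space by (simp del: space_eq_univ)
    finally show ?thesis .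
  qed
  then have "(LINT x|M. (x - ?m) ^ n) \<le> (LINT x|M. LINT y|M. (x - y) ^ n)"
    by (intro integral_mono integrable_power_diff sym_moment_fps_nth assms)
  also have "\<dots> \<le> cmod (of_real (LINT x|M. LINT y|M. (x - y) ^ n))"
    by simp
  also have "\<dots> = fact n * cmod (sym_moment_fps M $ n)"
    unfolding sym_moment_fps_nth(1)[OF assms(1), symmetric] by (simp add: norm_mult)
  finally show ?thesis by (simp add: field_simps)
qed

text \<open>With m the mean, the series of cosh(s (x - m)) has only nonnegative terms of even order,
  so \<open>central_moment_le\<close> allows termwise integration; a constant multiple of this cosh
  dominates exp(s |x|).\<close>

lemma integrable_exp_abs:
  assumes "\<And>k. integrable M (\<lambda>x. x ^ k)" "s \<ge> 0"
    and "summable (\<lambda>n. cmod (sym_moment_fps M $ n) * s ^ n)"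
  shows "integrable M (\<lambda>x. exp (s * \<bar>x\<bar>))"
proof -
  let ?m = "expectation (\<lambda>x. x)"
  define f where "f n x = (if even n then (s * (x - ?m)) ^ n /\<^sub>R fact n else 0)" for n and x :: real
  have sums: "(\<lambda>n. f n x) sums cosh (s * (x - ?m))" for x
    unfolding f_def by (rule cosh_converges)
  have nonneg: "f n x \<ge> 0" for n x
    by (auto simp: f_def zero_le_even_power)
  have "integrable M (\<lambda>x. \<Sum>n. f n x)"
  proof (rule integrable_suminf)
    show "integrable M (f n)" for n
      unfolding f_def power_mult_distrib
      by (cases "even n") (auto intro!: integrable_mult_right integrable_power_diff assms simp: divide_inverse mult.assoc)
    show "AE x in M. summable (\<lambda>n. norm (f n x))"
      using sums nonneg by (auto simp: sums_iff)
    have "norm (LINT x|M. norm (f n x)) \<le> cmod (sym_moment_fps M $ n) * s ^ n" for n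
    proof (cases "even n")
      case True
      have "(LINT x|M. norm (f n x)) = (LINT x|M. (x - ?m) ^ n * (s ^ n / fact n))"
      proof (intro Bochner_Integration.integral_cong refl)
        fix x :: real
        have "norm (f n x) = f n x" using nonneg[of n x] by simp
        then show "norm (f n x) = (x - ?m) ^ n * (s ^ n / fact n)"
          using True by (simp add: f_def power_mult_distrib divide_inverse mult_ac)
      qed
      also have "\<dots> = s ^ n * ((LINT x|M. (x - ?m) ^ n) / fact n)"
        by simp
      also have "\<dots> \<le> s ^ n * cmod (sym_moment_fps M $ n)"
        using assms(2) by (intro mult_left_mono central_moment_le assms True) auto
      finally show ?thesis by (simp add: mult.commute)
    qed (use assms in \<open>simp add: f_def\<close>)
    then show "summable (\<lambda>n. LINT x|M. norm (f n x))"
      by (intro summable_comparison_test[OF _ assms(3)]) auto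
  qed
  then have "integrable M (\<lambda>x. cosh (s * (x - ?m)))"
    using sums by (simp add: sums_iff)
  then have "integrable M (\<lambda>x. 2 * exp (s * \<bar>?m\<bar>) * cosh (s * (x - ?m)))"
    by (rule integrable_mult_right)
  then show ?thesis
  proof (rule Bochner_Integration.integrable_bound)
    show "AE x in M. norm (exp (s * \<bar>x\<bar>)) \<le> norm (2 * exp (s * \<bar>?m\<bar>) * cosh (s * (x - ?m)))"
    proof (rule AE_I2)
      fix x
      have "exp (s * \<bar>x\<bar>) \<le> exp (s * \<bar>?m\<bar> + s * \<bar>x - ?m\<bar>)"
        using mult_left_mono[OF _ assms(2), of "\<bar>x\<bar>" "\<bar>?m\<bar> + \<bar>x - ?m\<bar>"] by (simp add: distrib_left)
      also have "\<dots> = exp (s * \<bar>?m\<bar>) * exp (s * \<bar>x - ?m\<bar>)"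
        by (rule exp_add)
      also have "exp (s * \<bar>x - ?m\<bar>) \<le> 2 * cosh (s * (x - ?m))"
        by (cases "x \<ge> ?m") (auto simp: cosh_def abs_if right_diff_distrib)
      finally show "norm (exp (s * \<bar>x\<bar>)) \<le> norm (2 * exp (s * \<bar>?m\<bar>) * cosh (s * (x - ?m)))"
        by (simp add: mult_ac abs_mult)
    qed
  qed simp
qed

text \<open>Termwise integration of the exponential series: its absolute values add up to exp(|z|
  |x|), which is integrable by hypothesis.\<close>

lemma mgf_sums:
  assumes "\<And>s. integrable M (\<lambda>x. exp (s * \<bar>x\<bar>))" "\<And>k. integrable M (\<lambda>x. x ^ k)"
  shows "(\<lambda>n. moment_fps M $ n * z ^ n) sums mgf M z"
proof -
  define f where "f n x = (z * of_real x) ^ n /\<^sub>R fact n" for n and x :: real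
  have f_eq: "f n x = z ^ n / fact n * of_real (x ^ n)" for n x
    by (simp add: f_def power_mult_distrib scaleR_conv_of_real field_simps)
  have norm_f: "norm (f n x) = (norm z * \<bar>x\<bar>) ^ n /\<^sub>R fact n" for n x
    by (simp add: f_def norm_power norm_mult power_mult_distrib)
  have int: "integrable M (f n)" for n
    unfolding f_eq by (intro integrable_mult_right integrable_of_real assms)
  have sums: "(\<lambda>n. norm (f n x)) sums exp (norm z * \<bar>x\<bar>)" for x
    unfolding norm_f by (rule exp_converges)
  have "(\<lambda>n. LINT x|M. f n x) sums (LINT x|M. (\<Sum>n. f n x))"
  proof (rule sums_integral[OF int])
    show "AE x in M. summable (\<lambda>n. norm (f n x))" using sums by (auto simp: sums_iff)
    show "summable (\<lambda>n. LINT x|M. norm (f n x))"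
    proof (rule bounded_imp_summable)
      fix n
      have "(\<Sum>k\<le>n. LINT x|M. norm (f k x)) = (LINT x|M. (\<Sum>k\<le>n. norm (f k x)))"
        using int by (subst Bochner_Integration.integral_sum) auto
      also have "\<dots> \<le> (LINT x|M. exp (norm z * \<bar>x\<bar>))"
        using int assms(1) sums
        by (intro integral_mono) (auto intro!: sum_le_suminf[THEN order_trans] simp: sums_iff)
      finally show "(\<Sum>k\<le>n. LINT x|M. norm (f k x)) \<le> (LINT x|M. exp (norm z * \<bar>x\<bar>))" .
    qed simp
  qed
  also have "(LINT x|M. (\<Sum>n. f n x)) = mgf M z"
    unfolding mgf_def f_def using exp_converges by (auto simp: sums_iff intro!: Bochner_Integration.integral_cong)
  also have "(\<lambda>n. LINT x|M. f n x) = (\<lambda>n. moment_fps M $ n * z ^ n)"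
    unfolding f_eq integral_mult_right_zero integral_complex_of_real by (simp add: moment_fps_def mult.commute)
  finally show ?thesis .
qed

end

section \<open>Exponentials of polynomials with the ridge property\<close>

text \<open>Borel--Caratheodory, by applying the Schwarz lemma to \<open>u / (2 A - u)\<close>, where \<open>Re u < A\<close>.\<close>

lemma norm_le_of_Re_bound:
  fixes h :: "complex \<Rightarrow> complex"
  assumes hol: "h holomorphic_on UNIV" and "A > 0" "z \<noteq> 0"
    and A: "\<And>w. norm w < 2 * norm z \<Longrightarrow> Re (h w - h 0) < A"
  shows "norm (h z - h 0) \<le> 2 * A"
proof -
  \<comment> \<open>Twice |z| puts z / R at modulus 1/2, where the Schwarz lemma gives |g| \<le> 1/2
    and therefore |u| \<le> 2 A.\<close>
  define R where "R = 2 * norm z"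
  have "R > 0" using \<open>z \<noteq> 0\<close> by (simp add: R_def)
  define u where "u w = h (of_real R * w) - h 0" for w
  define g where "g w = u w / (2 * of_real A - u w)" for w
  have Re_u: "Re (u w) < A" if "norm w < 1" for w
    using A[of "of_real R * w"] that \<open>R > 0\<close> unfolding u_def by (simp add: R_def norm_mult)
  have nz: "2 * of_real A - u w \<noteq> 0" if "norm w < 1" for w
    using Re_u[OF that] \<open>A > 0\<close> by (auto simp: complex_eq_iff)
  have "u holomorphic_on ball 0 1"
    unfolding u_def by (intro holomorphic_intros holomorphic_on_compose_gen[OF _ hol, unfolded o_def]) auto
  then have "g holomorphic_on ball 0 1"
    unfolding g_def using nz by (intro holomorphic_intros) auto
  moreover have "g 0 = 0" by (simp add: g_def u_def)
  moreover have "norm (g w) < 1" if "norm w < 1" for w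
  proof -
    \<comment> \<open>The half-plane Re u < A consists of the points closer to 0 than to 2
      A.\<close>
    have "norm (2 * of_real A - u w) ^ 2 - norm (u w) ^ 2 = 4 * A * (A - Re (u w))"
      unfolding cmod_power2 by (simp add: power2_eq_square algebra_simps)
    also have "\<dots> > 0" using Re_u[OF that] \<open>A > 0\<close> by simp
    finally have "norm (u w) < norm (2 * of_real A - u w)"
      by (intro power2_less_imp_less[of "norm (u w)"]) auto
    then show ?thesis using nz[OF that] by (simp add: g_def norm_divide)
  qed
  moreover define w where "w = z / of_real R"
  have w: "norm w = 1 / 2" using \<open>R > 0\<close> by (simp add: w_def R_def norm_divide)
  ultimately have "norm (g w) \<le> 1 / 2"
    using Schwarz_Lemma(1)[of g w] by simp
  then have "norm (u w) \<le> norm (2 * of_real A - u w) / 2"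
    using nz[of w] w by (simp add: g_def norm_divide divide_simps split: if_splits)
  also have "norm (2 * of_real A - u w) \<le> 2 * A + norm (u w)"
    using norm_triangle_ineq4[of "2 * of_real A" "u w"] \<open>A > 0\<close> by simp
  finally have "norm (u w) \<le> 2 * A" by simp
  then show ?thesis using \<open>R > 0\<close> by (simp add: u_def w_def)
qed

text \<open>\<open>norm_le_of_Re_bound\<close> on the disc of radius 2 |z| turns the one-sided bound
  into |h z| = O(|z|^n), and Liouville's theorem for polynomial growth applies.\<close>

lemma entire_Re_poly_bound_imp_poly:
  fixes h :: "complex \<Rightarrow> complex"
  assumes hol: "h holomorphic_on UNIV" and "B \<ge> 0"
    and Re_h: "\<And>z. Re (h z) \<le> B * (1 + norm z) ^ n"
  shows "\<exists>p. \<forall>z. h z = poly p z"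
proof -
  define C where "C = norm (h 0)"
  have "C \<ge> 0" by (simp add: C_def)
  have bound: "norm (h z) \<le> (3 * C + 2 + 2 * B * 3 ^ n) * norm z ^ n" if "1 \<le> norm z" for z
  proof -
    \<comment> \<open>C absorbs - Re (h 0), and the summand 1 makes the required inequality
      strict.\<close>
    define A where "A = B * (1 + 2 * norm z) ^ n + C + 1"
    have "norm (h z - h 0) \<le> 2 * A"
    proof (rule norm_le_of_Re_bound[OF hol])
      show "A > 0" using \<open>B \<ge> 0\<close> \<open>C \<ge> 0\<close> by (simp add: A_def add_nonneg_pos)
      fix w :: complex assume "norm w < 2 * norm z"
      then have "B * (1 + norm w) ^ n \<le> B * (1 + 2 * norm z) ^ n"
        using \<open>B \<ge> 0\<close> by (intro mult_left_mono power_mono) auto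
      then show "Re (h w - h 0) < A"
        using Re_h[of w] abs_Re_le_cmod[of "h 0"] by (simp add: A_def C_def)
    qed (use that in auto)
    then have "norm (h z) \<le> C + 2 * A"
      using norm_triangle_sub[of "h z" "h 0"] by (simp add: C_def)
    also have "\<dots> = (3 * C + 2) * 1 + 2 * B * (1 + 2 * norm z) ^ n"
      by (simp add: A_def)
    also have "\<dots> \<le> (3 * C + 2) * norm z ^ n + 2 * B * (3 * norm z) ^ n"
      using that \<open>B \<ge> 0\<close> \<open>C \<ge> 0\<close> by (intro add_mono mult_left_mono power_mono one_le_power) auto
    also have "\<dots> = (3 * C + 2 + 2 * B * 3 ^ n) * norm z ^ n"
      by (simp add: power_mult_distrib algebra_simps)
    finally show ?thesis .
  qed
  have "h z = poly (\<Sum>k\<le>n. monom ((deriv ^^ k) h 0 / fact k) k) z" for z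
    using Liouville_polynomial[OF hol bound, of 1 z] by (simp add: poly_sum poly_monom)
  then show ?thesis by blast
qed

text \<open>Dividing by a power of r instead of r w admits w = 0 and compares a direction w with its
  real part under one normalisation.\<close>

lemma tendsto_poly_ray:
  fixes p :: "complex poly" and w :: complex
  shows "((\<lambda>r::real. poly p (of_real r * w) / of_real r ^ degree p) \<longlongrightarrow> lead_coeff p * w ^ degree p) at_top"
proof -
  let ?n = "degree p"
  have "((\<lambda>r::real. \<Sum>i\<le>?n. coeff p i * w ^ i * of_real (r ^ i / r ^ ?n)) \<longlongrightarrow>
      (\<Sum>i\<le>?n. coeff p i * w ^ i * of_real (if i = ?n then 1 else 0))) at_top"
  proof (intro tendsto_intros)
    fix i assume i: "i \<in> {..?n}"
    show "((\<lambda>r::real. r ^ i / r ^ ?n) \<longlongrightarrow> (if i = ?n then 1 else 0)) at_top"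
    proof (cases "i = ?n")
      case True
      then show ?thesis
        by (auto intro!: tendsto_eventually eventually_mono[OF eventually_gt_at_top[of "0::real"]])
    next
      case False
      have "((\<lambda>r::real. inverse (r ^ (?n - i))) \<longlongrightarrow> 0) at_top"
        using False i by (intro tendsto_inverse_0_at_top filterlim_pow_at_top filterlim_ident) auto
      moreover have "\<forall>\<^sub>F r::real in at_top. inverse (r ^ (?n - i)) = r ^ i / r ^ ?n"
        using eventually_gt_at_top[of 0]
        by eventually_elim (use i in \<open>auto simp: power_diff field_simps\<close>)
      ultimately show ?thesis using False by (auto dest: tendsto_cong)
    qed
  qed
  also have "(\<Sum>i\<le>?n. coeff p i * w ^ i * of_real (if i = ?n then 1 else 0)) = lead_coeff p * w ^ ?n"
    by (subst sum.remove[of _ ?n]) (auto intro!: sum.neutral)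
  finally show ?thesis
    by (simp add: poly_altdef power_mult_distrib sum_divide_distrib mult_ac)
qed

text \<open>Marcinkiewicz: compare both sides along the rays \<open>arg z = (2 k \<pi> - arg a) / n\<close>,
  where \<open>a\<close> is the leading coefficient.\<close>

lemma ridge_poly_degree_le:
  fixes p :: "complex poly"
  assumes ridge: "\<And>z. Re (poly p z) \<le> Re (poly p (of_real (Re z)))"
  shows "degree p \<le> 2"
proof (rule ccontr)
  assume "\<not> degree p \<le> 2"
  define n where "n = degree p"
  have n: "n \<ge> 3" using \<open>\<not> degree p \<le> 2\<close> by (simp add: n_def)
  define a where "a = lead_coeff p"
  have "a \<noteq> 0" using n by (auto simp: a_def n_def)
  \<comment> \<open>Only the leading term survives when the inequality at r w is divided by r^n and
    r tends to infinity.\<close>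
  have ray: "Re (a * w ^ n) \<le> Re (a * of_real (Re w) ^ n)" for w
  proof -
    have lim: "((\<lambda>r::real. Re (poly p (of_real r * w) / of_real r ^ n)) \<longlongrightarrow> Re (a * w ^ n)) at_top"
      "((\<lambda>r::real. Re (poly p (of_real r * of_real (Re w)) / of_real r ^ n)) \<longlongrightarrow> Re (a * of_real (Re w) ^ n)) at_top"
      unfolding a_def n_def by (intro tendsto_Re tendsto_poly_ray)+
    have "\<forall>\<^sub>F r in at_top. Re (poly p (of_real r * w) / of_real r ^ n) \<le>
        Re (poly p (of_real r * of_real (Re w)) / of_real r ^ n)"
      using eventually_gt_at_top[of 0]
    proof eventually_elim
      case (elim r)
      have "Re (z / of_real r ^ n) = Re z / r ^ n" for z
        by (metis Re_divide_of_real of_real_power)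
      then show ?case using ridge[of "of_real r * w"] elim by (simp add: divide_right_mono)
    qed
    then show ?thesis by (rule tendsto_le[OF trivial_limit_at_top_linorder lim(2) lim(1)])
  qed
  define \<alpha> where "\<alpha> = Arg a"
  \<comment> \<open>At w = cis \<eta>, for \<eta> the angle in question, the left side of
    \<open>ray\<close> is |a| and the right side at most |a| |cos \<eta>|^n, so |cos \<eta>| =
    1.\<close>
  have sin0: "sin ((2 * pi * real k - \<alpha>) / n) = 0" for k
  proof -
    define \<eta> where "\<eta> = (2 * pi * real k - \<alpha>) / n"
    have "a = of_real (norm a) * cis \<alpha>"
      by (metis \<alpha>_def cis_Arg complex_sgn_def rcis_cmod_Arg rcis_def)
    then have "a * cis \<eta> ^ n = of_real (norm a) * (cis \<alpha> * cis \<eta> ^ n)"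
      by (metis mult.assoc)
    also have "cis \<alpha> * cis \<eta> ^ n = cis (\<alpha> + n * \<eta>)"
      by (simp add: Complex.DeMoivre cis_mult)
    also have "\<alpha> + n * \<eta> = 2 * pi * real k" using n by (simp add: \<eta>_def)
    also have "cis (2 * pi * real k) = 1" by (intro cis_multiple_2pi) auto
    finally have "norm a \<le> Re (a * of_real (cos \<eta>) ^ n)"
      using ray[of "cis \<eta>"] by simp
    also have "\<dots> \<le> norm (a * of_real (cos \<eta>) ^ n)" by (rule complex_Re_le_cmod)
    also have "\<dots> = norm a * \<bar>cos \<eta>\<bar> ^ n" by (simp add: norm_mult norm_power)
    finally have "1 \<le> \<bar>cos \<eta>\<bar> ^ n" using \<open>a \<noteq> 0\<close> by simp
    then have "\<bar>cos \<eta>\<bar> \<ge> 1" using n power_less_one_iff[of "\<bar>cos \<eta>\<bar>" n] by force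
    then have "(cos \<eta>)\<^sup>2 \<ge> 1" by (metis abs_square_le_1 abs_le_square_iff abs_one one_power2)
    then have "(sin \<eta>)\<^sup>2 \<le> 0" using sin_squared_eq[of \<eta>] by simp
    then show ?thesis by (simp add: \<eta>_def)
  qed
  \<comment> \<open>Both angles are multiples of \<pi>, so their difference 2 \<pi> / n is one too,
    although it lies strictly between 0 and \<pi> for n \<ge> 3.\<close>
  have "sin (2 * pi / n) = sin ((2 * pi * real 1 - \<alpha>) / n - (2 * pi * real 0 - \<alpha>) / n)"
    by (simp add: diff_divide_distrib)
  also have "\<dots> = 0" unfolding sin_diff sin0 by simp
  finally have "sin (2 * pi / n) = 0" .
  moreover have "sin (2 * pi / n) > 0"
    using n by (intro sin_gt_zero) (auto simp: field_simps)
  ultimately show False by simp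
qed

text \<open>For z = x + \<i> y the inequality reads 0 \<le> y (Im a + 2 x Im b + y Re b), where a
  and b are the coefficients of degree 1 and 2. Letting y tend to 0 from both sides kills Im a + 2 x
  Im b for every x, so a and b are real; x = 0, y = 1 then gives Re b \<ge> 0.\<close>

lemma ridge_poly_quadratic:
  fixes p :: "complex poly"
  assumes ridge: "\<And>z. Re (poly p z) \<le> Re (poly p (of_real (Re z)))"
  obtains \<mu> \<tau> :: real where "\<tau> \<ge> 0" "\<And>z. poly p z = poly p 0 + of_real \<mu> * z + of_real \<tau> * z\<^sup>2"
proof -
  define a b where "a = coeff p 1" and "b = coeff p 2"
  have p: "poly p z = poly p 0 + a * z + b * z\<^sup>2" for z
  proof -
    have "poly p z = (\<Sum>i\<le>2. coeff p i * z ^ i)"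
      by (rule poly_as_sum_of_monoms'[OF ridge_poly_degree_le[OF ridge], THEN arg_cong[of _ _ "\<lambda>p. poly p z"], symmetric, unfolded poly_sum poly_monom])
    then show ?thesis by (simp add: a_def b_def numeral_2_eq_2 poly_0_coeff_0)
  qed
  have *: "0 \<le> y * (Im a + 2 * Im b * x + Re b * y)" for x y
    using ridge[of "Complex x y"]
    by (simp add: p[of "Complex x y"] p[of "of_real x"] power2_eq_square algebra_simps)
  have "Im a + 2 * Im b * x = 0" for x
  proof -
    define c where "c = Im a + 2 * Im b * x"
    have "((\<lambda>y. c + Re b * y) \<longlongrightarrow> c + Re b * 0) (at_right 0)" "((\<lambda>y. c + Re b * y) \<longlongrightarrow> c + Re b * 0) (at_left 0)"
      by (intro tendsto_intros)+
    moreover have "\<forall>\<^sub>F y in at_right 0. 0 \<le> c + Re b * y"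
      using eventually_at_right_less[of "0::real"]
    proof eventually_elim
      case (elim y)
      then show ?case using *[of y x] by (auto simp: c_def zero_le_mult_iff)
    qed
    moreover have "\<forall>\<^sub>F y in at_left 0. y < (0::real)"
      by (simp add: eventually_at_filter)
    then have "\<forall>\<^sub>F y in at_left 0. c + Re b * y \<le> 0"
    proof eventually_elim
      case (elim y)
      then show ?case using *[of y x] by (auto simp: c_def zero_le_mult_iff)
    qed
    ultimately have "0 \<le> c" "c \<le> 0"
      using tendsto_lowerbound[of "\<lambda>y. c + Re b * y" _ "at_right 0" 0]
        tendsto_upperbound[of "\<lambda>y. c + Re b * y" _ "at_left 0" 0] by auto
    then show ?thesis by (simp add: c_def)
  qed
  from this[of 0] this[of 1] have im: "Im a = 0" "Im b = 0" by auto
  have "Re b \<ge> 0" using *[of 1 0] im by simp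
  moreover have "a = of_real (Re a)" "b = of_real (Re b)" using im by (auto simp: complex_eq_iff)
  ultimately show ?thesis using that[of "Re b" "Re a"] p by metis
qed

text \<open>exp(Q) is entire, so its expansion has infinite radius of convergence; this supplies the
  summability that \<open>integrable_exp_abs\<close> asks for.\<close>

lemma summable_of_exp_poly_expansion:
  assumes "(\<lambda>z. exp (poly Q z)) has_fps_expansion A"
  shows "summable (\<lambda>n. cmod (A $ n) * s ^ n)"
proof -
  have "(\<lambda>z. exp (poly Q z)) holomorphic_on eball 0 \<infinity>"
    by (intro holomorphic_intros)
  from holomorphic_on_imp_fps_conv_radius_ge[OF assms this] have "fps_conv_radius A = \<infinity>"
    by simp
  then have "summable (\<lambda>n. norm (A $ n * of_real \<bar>s\<bar> ^ n))"
    by (intro abs_summable_in_conv_radius) (simp add: fps_conv_radius_def)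
  then have "summable (\<lambda>n. cmod (A $ n) * \<bar>s\<bar> ^ n)"
    by (simp add: norm_mult norm_power)
  then show ?thesis
    by (rule summable_comparison_test'[where N=0]) (simp add: abs_mult power_abs)
qed

section \<open>The moment generating function as an entire function\<close>

context real_distribution
begin

context
  assumes exp_moments: "\<And>s. integrable M (\<lambda>x. exp (s * \<bar>x\<bar>))"
    and moments: "\<And>k. integrable M (\<lambda>x. x ^ k)"
begin

lemma mgf_has_fps_expansion: "mgf M has_fps_expansion moment_fps M"
  by (intro has_fps_expansionI always_eventually allI mgf_sums exp_moments moments)

lemma mgf_uminus_has_fps_expansion: "(\<lambda>z. mgf M (- z)) has_fps_expansion fps_dilate (-1) (moment_fps M)"
proof (intro has_fps_expansionI always_eventually allI)
  fix z
  have "moment_fps M $ n * (- z) ^ n = fps_dilate (-1) (moment_fps M) $ n * z ^ n" for n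
    by (simp add: power_minus[of z])
  then show "(\<lambda>n. fps_dilate (-1) (moment_fps M) $ n * z ^ n) sums mgf M (- z)"
    using mgf_sums[OF exp_moments moments, of "- z"] by presburger
qed

lemma mgf_holomorphic: "mgf M holomorphic_on A"
proof -
  have "mgf M field_differentiable (at z)" for z
  proof -
    have "mgf M holomorphic_on ball 0 (norm z + 1)"
      by (rule power_series_holomorphic[where a="fps_nth (moment_fps M)"])
         (use mgf_sums[OF exp_moments moments] in simp)
    then show ?thesis
      by (rule holomorphic_on_imp_differentiable_at) auto
  qed
  then show ?thesis
    by (simp add: holomorphic_on_def field_differentiable_at_within)
qed

text \<open>Both sides are entire with expansion \<open>sym_moment_fps M\<close> at 0, so the
  identity theorem extends the formal identity to the whole plane.\<close>

lemma mgf_mult_uminus: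
  assumes "(\<lambda>z. exp (poly Q z)) has_fps_expansion sym_moment_fps M"
  shows "mgf M z * mgf M (- z) = exp (poly Q z)"
proof -
  let ?h = "\<lambda>z. mgf M z * mgf M (- z) - exp (poly Q z)"
  have "?h has_fps_expansion sym_moment_fps M - sym_moment_fps M"
    unfolding sym_moment_fps_def using assms
    by (intro has_fps_expansion_diff has_fps_expansion_mult mgf_has_fps_expansion mgf_uminus_has_fps_expansion)
       (simp add: sym_moment_fps_def)
  then have exp0: "?h has_fps_expansion 0" by simp
  have "?h holomorphic_on UNIV"
    by (intro holomorphic_intros mgf_holomorphic holomorphic_on_compose_gen[OF _ mgf_holomorphic[of UNIV], unfolded o_def]) auto
  from has_fps_expansion_0_analytic_continuation[OF exp0 this open_UNIV connected_UNIV, of z]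
  show ?thesis by simp
qed

lemma integrable_mgf: "integrable M (\<lambda>x. exp (z * complex_of_real x))"
proof (rule Bochner_Integration.integrable_bound[OF exp_moments[of "norm z"]])
  show "AE x in M. norm (exp (z * complex_of_real x)) \<le> norm (exp (norm z * \<bar>x\<bar>))"
    using complex_Re_le_cmod[of "z * of_real x" for x] by (auto simp: norm_mult)
qed simp

lemma mgf_of_real: "mgf M (of_real s) = of_real (LINT x|M. exp (s * x))"
proof -
  have "exp (of_real s * complex_of_real x) = of_real (exp (s * x))" for x
    by (metis exp_of_real of_real_mult)
  then show ?thesis unfolding mgf_def by (simp only: integral_complex_of_real)
qed

lemma integrable_exp_real: "integrable M (\<lambda>x. exp (s * x))"
  using integrable_Re[OF integrable_mgf[of "of_real s"]] by (simp add: Re_exp)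

text \<open>This integrates a tangent line of the exponential. Applied at -s, the lower bound turns
  F(s) F(-s) = exp(Q(s)), with F = \<open>mgf M\<close>, into an upper bound for F(s).\<close>

lemma mgf_of_real_ge: "norm (mgf M (of_real s)) \<ge> exp (s * expectation (\<lambda>x. x))"
proof -
  let ?m = "expectation (\<lambda>x. x)"
  have int1: "integrable M (\<lambda>x. x)" using moments[of 1] by simp
  have "(LINT x|M. exp (s * ?m) * (1 + s * (x - ?m))) \<le> (LINT x|M. exp (s * x))"
  proof (rule integral_mono)
    fix x
    have "exp (s * ?m) * (1 + s * (x - ?m)) \<le> exp (s * ?m) * exp (s * (x - ?m))"
      by (intro mult_left_mono exp_ge_add_one_self) auto
    also have "\<dots> = exp (s * x)" by (simp flip: exp_add add: right_diff_distrib)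
    finally show "exp (s * ?m) * (1 + s * (x - ?m)) \<le> exp (s * x)" .
  qed (use int1 integrable_exp_real in auto)
  moreover have "(LINT x|M. exp (s * ?m) * (1 + s * (x - ?m))) = exp (s * ?m)"
    using int1 prob_space by (simp del: space_eq_univ)
  ultimately show ?thesis by (simp add: mgf_of_real)
qed

text \<open>The ridge property, from |exp(z x)| = exp(x Re z).\<close>

lemma norm_mgf_le: "norm (mgf M z) \<le> norm (mgf M (of_real (Re z)))"
proof -
  have "norm (mgf M z) \<le> (LINT x|M. norm (exp (z * of_real x)))"
    unfolding mgf_def by (rule integral_norm_bound)
  then show ?thesis by (simp add: mgf_of_real)
qed

lemma mgf_eq_exp_poly:
  assumes "\<And>z. mgf M z * mgf M (- z) = exp (poly Q z)"
  shows "\<exists>p. \<forall>z. mgf M z = exp (poly p z)"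
proof -
  let ?m = "expectation (\<lambda>x. x)"
  have nz: "mgf M z \<noteq> 0" for z using assms[of z] by auto
  have "simply_connected (UNIV :: complex set)" by (intro convex_imp_simply_connected) auto
  then obtain h where h: "h holomorphic_on UNIV" "\<And>z. mgf M z = exp (h z)"
    using simply_connected_eq_holomorphic_log[of UNIV] mgf_holomorphic[of UNIV] nz by auto
  \<comment> \<open>The successor keeps d \<ge> 1 even for constant Q, so that the linear term from
    the mean is absorbed as well.\<close>
  define d where "d = Suc (degree Q)"
  define B where "B = (\<Sum>i\<le>degree Q. norm (coeff Q i)) + \<bar>?m\<bar>"
  have "B \<ge> 0" by (auto simp: B_def intro!: add_nonneg_nonneg sum_nonneg)
  have "Re (h z) \<le> B * (1 + norm z) ^ d" for z
  proof -
    let ?s = "Re z"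
    have "exp (Re (h z)) = norm (mgf M z)" by (simp add: h(2))
    also have "\<dots> \<le> norm (mgf M (of_real ?s))" by (rule norm_mgf_le)
    \<comment> \<open>The calculation so far is multiplied by exp(-m Re z), which bounds the
      generating function at -Re z from below.\<close>
    also have "\<dots> * exp (- ?s * ?m) \<le> norm (mgf M (of_real ?s)) * norm (mgf M (of_real (- ?s)))"
      using mgf_of_real_ge[of "- ?s"] by (intro mult_left_mono) auto
    also have "\<dots> = norm (exp (poly Q (of_real ?s)))"
      by (simp flip: norm_mult assms)
    also have "\<dots> \<le> exp (norm (poly Q (of_real ?s)))"
      by (simp add: complex_Re_le_cmod)
    finally have "exp (Re (h z) - ?s * ?m) \<le> exp (norm (poly Q (of_real ?s)))"
      by (simp add: exp_diff exp_minus divide_inverse)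
    then have "Re (h z) \<le> norm (poly Q (of_real ?s)) + ?s * ?m"
      by simp
    also have "norm (poly Q (of_real ?s)) \<le> (\<Sum>i\<le>degree Q. norm (coeff Q i) * (1 + norm z) ^ d)"
      unfolding poly_altdef
    proof (rule sum_norm_le)
      fix i assume "i \<in> {..degree Q}"
      then have "(1 + norm z) ^ i \<le> (1 + norm z) ^ d"
        by (intro power_increasing) (auto simp: d_def)
      moreover have "\<bar>?s\<bar> ^ i \<le> (1 + norm z) ^ i"
        using abs_Re_le_cmod[of z] by (intro power_mono) auto
      ultimately show "norm (coeff Q i * of_real ?s ^ i) \<le> norm (coeff Q i) * (1 + norm z) ^ d"
        by (auto simp: norm_mult norm_power intro!: mult_left_mono)
    qed
    also have "?s * ?m \<le> \<bar>?m\<bar> * (1 + norm z) ^ d"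
    proof -
      have "?s * ?m \<le> \<bar>?m\<bar> * \<bar>?s\<bar>" by (metis abs_ge_self abs_mult mult.commute)
      also have "\<bar>?s\<bar> \<le> (1 + norm z) ^ 1" using abs_Re_le_cmod[of z] by simp
      also have "\<dots> \<le> (1 + norm z) ^ d" by (intro power_increasing) (auto simp: d_def)
      finally show ?thesis by (simp add: mult_left_mono)
    qed
    finally show ?thesis by (simp add: B_def sum_distrib_right distrib_right)
  qed
  from entire_Re_poly_bound_imp_poly[OF h(1) \<open>B \<ge> 0\<close> this] show ?thesis
    using h(2) by auto
qed

lemma char_quadratic_of_mgf:
  assumes "\<And>z. mgf M z = exp (poly p z)"
  shows "\<exists>\<mu> \<tau>. \<tau> \<ge> 0 \<and> (\<forall>t. char M t = exp (\<i> * of_real (\<mu> * t) - of_real (\<tau> * t\<^sup>2)))"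
proof -
  have "Re (poly p z) \<le> Re (poly p (of_real (Re z)))" for z
    using norm_mgf_le[of z] by (simp add: assms)
  from ridge_poly_quadratic[OF this] obtain \<tau> \<mu> :: real
    where \<tau>: "\<tau> \<ge> 0" and p: "\<And>z. poly p z = poly p 0 + of_real \<mu> * z + of_real \<tau> * z\<^sup>2"
    by blast
  \<comment> \<open>The total mass 1 disposes of the constant term, which may still be any multiple
    of 2 \<pi> \<i>.\<close>
  have "exp (poly p 0) = 1"
    using char_zero char_eq_mgf[of M 0] assms[of 0] by simp
  then have "char M t = exp (\<i> * of_real (\<mu> * t) - of_real (\<tau> * t\<^sup>2))" for t
    unfolding char_eq_mgf assms p[of "\<i> * of_real t"]
    by (simp add: exp_add exp_diff exp_minus power_mult_distrib divide_inverse mult_ac)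
  then show ?thesis using \<tau> by blast
qed

end

text \<open>Here M is any law with finite moments, so the quadratic may degenerate: \<tau> = 0 is a
  point mass, which is excluded later by the existence of a density.\<close>

theorem char_prod_eq_imp_quadratic:
  assumes "finite I" "\<And>k. integrable M (\<lambda>x. x ^ k)"
    and "\<And>t. (\<Prod>i\<in>I. char M (b i * t)) = (\<Prod>i\<in>I. char M (c i * t))"
    and "image_mset (\<lambda>i. \<bar>b i\<bar>) (mset_set I) \<noteq> image_mset (\<lambda>i. \<bar>c i\<bar>) (mset_set I)"
  shows "\<exists>\<mu> \<tau>. \<tau> \<ge> 0 \<and> (\<forall>t. char M t = exp (\<i> * of_real (\<mu> * t) - of_real (\<tau> * t\<^sup>2)))"
proof -
  obtain Q where Q: "(\<lambda>z. exp (poly Q z)) has_fps_expansion sym_moment_fps M"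
    using sym_moment_fps_exp_poly[OF assms] by blast
  have exp_moments: "integrable M (\<lambda>x. exp (s * \<bar>x\<bar>))" for s
  proof (cases "s \<ge> 0")
    case True
    then show ?thesis by (intro integrable_exp_abs assms summable_of_exp_poly_expansion[OF Q])
  next
    case False
    then show ?thesis by (intro integrable_const_bound[of _ 1]) (auto simp: mult_nonpos_nonneg)
  qed
  obtain p where "\<And>z. mgf M z = exp (poly p z)"
    using mgf_eq_exp_poly[OF exp_moments assms(2) mgf_mult_uminus[OF exp_moments assms(2) Q]] by blast
  then show ?thesis by (rule char_quadratic_of_mgf[OF exp_moments assms(2)])
qed

end

section \<open>Densities and characteristic functions\<close>

no_notation fps_nth (infixl "$" 75)
unbundle vec_syntax

lemma real_distribution_density:
  assumes "prob_density f"
  shows "real_distribution (density lborel (\<lambda>x. ennreal (f x)))"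
proof -
  have "emeasure (density lborel (\<lambda>x. ennreal (f x))) UNIV = (\<integral>\<^sup>+x. ennreal (f x) \<partial>lborel)"
    using assms by (subst emeasure_density) (auto simp: prob_density_def)
  also have "\<dots> = 1"
    using assms by (subst nn_integral_eq_integral) (auto simp: prob_density_def)
  finally have "prob_space (density lborel (\<lambda>x. ennreal (f x)))"
    by (intro prob_spaceI) simp
  then show ?thesis
    by (simp add: real_distribution_def real_distribution_axioms_def)
qed

lemma char_normal_density:
  assumes "\<sigma> > 0"
  shows "char (density lborel (\<lambda>x. ennreal (normal_density \<mu> \<sigma> x))) t =
    exp (\<i> * of_real (\<mu> * t) - of_real (\<sigma>\<^sup>2 / 2 * t\<^sup>2))"
proof -
  interpret S: real_distribution std_normal_distribution by (rule real_dist_normal_dist)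
  have "distributed std_normal_distribution lborel (\<lambda>x. x) std_normal_density"
    by (auto simp: distributed_def distr_id2)
  from S.normal_density_affine[OF this, of \<sigma> \<mu>] assms
  have "density lborel (\<lambda>x. ennreal (normal_density \<mu> \<sigma> x)) = distr std_normal_distribution lborel (\<lambda>x. \<mu> + \<sigma> * x)"
    by (simp add: distributed_def)
  then have "char (density lborel (\<lambda>x. ennreal (normal_density \<mu> \<sigma> x))) t =
      (CLINT x|std_normal_distribution. iexp (t * (\<mu> + \<sigma> * x)))"
    unfolding char_def by (simp add: integral_distr)
  also have "\<dots> = (CLINT x|std_normal_distribution. iexp (\<mu> * t) * iexp ((\<sigma> * t) * x))"
    by (intro Bochner_Integration.integral_cong refl) (simp add: algebra_simps flip: exp_add)
  also have "\<dots> = iexp (\<mu> * t) * char std_normal_distribution (\<sigma> * t)"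
    unfolding char_def by (rule integral_mult_right_zero)
  also have "\<dots> = exp (\<i> * of_real (\<mu> * t) + of_real (- ((\<sigma> * t)\<^sup>2 / 2)))"
    unfolding char_std_normal_distribution exp_add exp_of_real by simp
  finally show ?thesis by (simp add: power_mult_distrib)
qed

text \<open>For \<tau> > 0, Levy's uniqueness theorem identifies the law with a normal one of
  variance 2 \<tau>. Equal measures have densities equal almost everywhere, as
  \<open>gaussian_density\<close> asks.\<close>

lemma gaussian_density_of_char:
  assumes f: "prob_density f" and "\<tau> \<ge> 0"
    and char: "\<And>t. char (density lborel (\<lambda>x. ennreal (f x))) t = exp (\<i> * of_real (\<mu> * t) - of_real (\<tau> * t\<^sup>2))"
  shows "gaussian_density f"
proof -
  let ?D = "density lborel (\<lambda>x. ennreal (f x))"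
  interpret D: real_distribution ?D by (rule real_distribution_density[OF f])
  have [measurable]: "f \<in> borel_measurable lborel" and nonneg: "\<And>x. f x \<ge> 0"
    using f by (auto simp: prob_density_def)
  show ?thesis
  proof (cases "\<tau> = 0")
    case True
    \<comment> \<open>For \<tau> = 0 the law would be a point mass, but a law with a density gives
      singletons mass 0.\<close>
    have "real_distribution (return borel \<mu>)"
      by (simp add: real_distribution_def real_distribution_axioms_def prob_space_return)
    moreover have "char ?D = char (return borel \<mu>)"
      using char True by (auto simp: char_def integral_return mult.commute)
    ultimately have "?D = return borel \<mu>"
      using Levy_uniqueness D.real_distribution_axioms by blast
    then have "emeasure ?D {\<mu>} = 1" by simp
    moreover have "emeasure ?D {\<mu>} = (\<integral>\<^sup>+x. ennreal (f x) * indicator {\<mu>} x \<partial>lborel)"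
      by (subst emeasure_density) auto
    moreover have "\<dots> = 0"
      by (subst nn_integral_0_iff_AE) (auto intro!: AE_I'[of "{\<mu>}"] simp: null_sets_def indicator_def)
    ultimately show ?thesis by simp
  next
    case False
    define \<sigma> where "\<sigma> = sqrt (2 * \<tau>)"
    have \<sigma>: "\<sigma> > 0" "\<sigma>\<^sup>2 / 2 = \<tau>" using False assms(2) by (auto simp: \<sigma>_def)
    let ?G = "density lborel (\<lambda>x. ennreal (normal_density \<mu> \<sigma> x))"
    have "real_distribution ?G"
      using \<sigma>(1) prob_space_normal_density by (simp add: real_distribution_def real_distribution_axioms_def)
    moreover have "char ?D = char ?G"
      using char char_normal_density[OF \<sigma>(1)] \<sigma>(2) by auto
    ultimately have "?D = ?G"
      using Levy_uniqueness D.real_distribution_axioms by blast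
    then have "AE x in lborel. ennreal (f x) = ennreal (normal_density \<mu> \<sigma> x)"
      by (intro sigma_finite_measure.density_unique[OF sigma_finite_lborel]) auto
    then have "AE x in lborel. f x = normal_density \<mu> \<sigma> x"
      using nonneg by (auto simp: ennreal_inj)
    then show ?thesis unfolding gaussian_density_def using \<sigma>(1) by blast
  qed
qed

lemma char_density:
  assumes "f \<in> borel_measurable borel" "\<And>x. f x \<ge> 0"
  shows "char (density lborel (\<lambda>x. ennreal (f x))) t = (CLINT x|lborel. f x *\<^sub>R iexp (t * x))"
  unfolding char_def using assms by (subst integral_density) auto

lemma prob_density_measurable: "prob_density f \<Longrightarrow> f \<in> borel_measurable borel"
  by (auto simp: prob_density_def)

text \<open>A variable with the scaled density is distributed as 1 / l times one with density
  f.\<close>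

lemma char_distributed_scaled_density:
  assumes f: "prob_density f" and "l > 0" and X: "distributed M lborel X (\<lambda>x. ennreal (scaled_density l f x))"
  shows "char (distr M borel X) t = char (density lborel (\<lambda>x. ennreal (f x))) (t / l)"
proof -
  have [measurable]: "f \<in> borel_measurable borel" and nonneg: "\<And>x. f x \<ge> 0"
    using f prob_density_measurable by (auto simp: prob_density_def)
  have "distr M borel X = distr M lborel X" by (intro distr_cong) auto
  also have "\<dots> = density lborel (\<lambda>x. ennreal (scaled_density l f x))"
    using X by (simp add: distributed_def)
  finally have "char (distr M borel X) t = (CLINT x|lborel. scaled_density l f x *\<^sub>R iexp (t * x))"
    using nonneg \<open>l > 0\<close> by (simp add: char_density scaled_density_def)
  also have "\<dots> = l *\<^sub>R (CLINT x|lborel. f (0 + l * x) *\<^sub>R iexp (t / l * (0 + l * x)))"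
    using \<open>l > 0\<close> unfolding integral_scaleR_right[symmetric]
    by (intro Bochner_Integration.integral_cong) (auto simp: scaled_density_def)
  also have "\<dots> = (CLINT x|lborel. f x *\<^sub>R iexp (t / l * x))"
    using \<open>l > 0\<close> by (subst lborel_integral_real_affine[of l _ 0]) auto
  also have "\<dots> = char (density lborel (\<lambda>x. ennreal (f x))) (t / l)"
    using nonneg by (simp add: char_density)
  finally show ?thesis .
qed

lemma char_symmetric_density:
  assumes f: "prob_density f" and sym: "symmetric_density f"
  shows "char (density lborel (\<lambda>x. ennreal (f x))) (- t) = char (density lborel (\<lambda>x. ennreal (f x))) t"
proof -
  have [measurable]: "f \<in> borel_measurable borel" and nonneg: "\<And>x. f x \<ge> 0"
    using f prob_density_measurable by (auto simp: prob_density_def)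
  have "(CLINT x|lborel. f x *\<^sub>R iexp (- t * x)) = (CLINT x|lborel. f (- x) *\<^sub>R iexp (t * x))"
    by (subst lborel_integral_real_affine[of "-1" _ 0]) auto
  also have "\<dots> = (CLINT x|lborel. f x *\<^sub>R iexp (t * x))"
    using sym unfolding symmetric_density_def by (intro integral_cong_AE) (auto elim: eventually_mono)
  finally show ?thesis using nonneg by (simp add: char_density)
qed

lemma moments_density:
  assumes f: "prob_density f"
    and moments: "\<And>m::real. m > 0 \<Longrightarrow> integrable lborel (\<lambda>x. \<bar>x\<bar> powr m * f x)"
  shows "integrable (density lborel (\<lambda>x. ennreal (f x))) (\<lambda>x. x ^ k)"
proof -
  have [measurable]: "f \<in> borel_measurable borel" and nonneg: "\<And>x. f x \<ge> 0"
    using f prob_density_measurable by (auto simp: prob_density_def)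
  have "integrable lborel (\<lambda>x. f x * x ^ k)"
  \<comment> \<open>The hypothesis covers m > 0 only; order 0 is the integrability of f
    itself.\<close>
  proof (cases "k = 0")
    case True
    then show ?thesis using f by (simp add: prob_density_def)
  next
    case False
    have "\<bar>x\<bar> powr real k = \<bar>x\<bar> ^ k" for x :: real
      using False by (cases "x = 0") (auto simp: powr_realpow)
    then have "integrable lborel (\<lambda>x. \<bar>x\<bar> ^ k * f x)"
      using moments[of "real k"] False by simp
    then show ?thesis
      by (rule Bochner_Integration.integrable_bound) (auto simp: abs_mult power_abs mult.commute)
  qed
  then show ?thesis
    using nonneg by (subst integrable_density) (auto simp: scaleR_conv_of_real)
qed

text \<open>Events generated by g(U) are among those generated by U. This reduces a pair with
  different value types to two real variables, to which \<open>char_distr_add\<close>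
  applies.\<close>

lemma (in prob_space) indep_var_compose_indep_rv:
  assumes "indep_rv S U borel V" "g \<in> borel_measurable S"
  shows "indep_var borel (\<lambda>\<omega>. g (U \<omega>)) borel V"
proof -
  let ?A = "\<lambda>T U. {U -` A \<inter> space M | A. A \<in> sets T}"
  have rv: "random_variable S U" "random_variable borel V"
    and ind: "indep_set (sigma_sets (space M) (?A S U)) (sigma_sets (space M) (?A borel V))"
    using assms(1) unfolding indep_rv_def by auto
  have "?A borel (\<lambda>\<omega>. g (U \<omega>)) \<subseteq> ?A S U"
  proof
    fix B assume "B \<in> ?A borel (\<lambda>\<omega>. g (U \<omega>))"
    then obtain A where A: "A \<in> sets borel" "B = (\<lambda>\<omega>. g (U \<omega>)) -` A \<inter> space M" by blast
    then have "B = U -` (g -` A \<inter> space S) \<inter> space M"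
      using measurable_space[OF rv(1)] by auto
    then show "B \<in> ?A S U" using measurable_sets[OF assms(2) A(1)] by blast
  qed
  then have "indep_set (sigma_sets (space M) (?A borel (\<lambda>\<omega>. g (U \<omega>)))) (sigma_sets (space M) (?A borel V))"
    using ind unfolding indep_set_def
    by (elim indep_sets_mono_sets) (auto split: bool.split dest: sigma_sets_mono'[THEN subsetD])
  then show ?thesis
    unfolding indep_var_eq using rv assms(2) by auto
qed

text \<open>Independence splits off e and then separates the coordinates, so \<beta> and l enter
  only through the ratios \<beta>_j / l_j.\<close>

lemma (in prob_space) char_distr_inner_add:
  fixes X :: "'a \<Rightarrow> real ^ 'd" and e :: "'a \<Rightarrow> real" and l \<beta> :: "real ^ 'd"
  assumes f: "prob_density f" and l: "\<And>j. l $ j > 0"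
    and indep: "indep_vars (\<lambda>_. borel) (\<lambda>j \<omega>. X \<omega> $ j) UNIV"
    and X: "\<And>j. distributed M lborel (\<lambda>\<omega>. X \<omega> $ j) (scaled_density (l $ j) f)"
    and e: "indep_rv borel X borel e"
  shows "char (distr M borel (\<lambda>\<omega>. \<beta> \<bullet> X \<omega> + e \<omega>)) t =
    (\<Prod>j\<in>UNIV. char (density lborel (\<lambda>x. ennreal (f x))) (\<beta> $ j / l $ j * t)) * char (distr M borel e) t"
proof -
  have "indep_var borel (\<lambda>\<omega>. \<beta> \<bullet> X \<omega>) borel e"
    by (rule indep_var_compose_indep_rv[OF e]) auto
  then have "char (distr M borel (\<lambda>\<omega>. \<beta> \<bullet> X \<omega> + e \<omega>)) t =
      char (distr M borel (\<lambda>\<omega>. \<beta> \<bullet> X \<omega>)) t * char (distr M borel e) t"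
    by (rule char_distr_add)
  also have "(\<lambda>\<omega>. \<beta> \<bullet> X \<omega>) = (\<lambda>\<omega>. \<Sum>j\<in>UNIV. \<beta> $ j * X \<omega> $ j)"
    by (simp add: inner_vec_def)
  also have "char (distr M borel (\<lambda>\<omega>. \<Sum>j\<in>UNIV. \<beta> $ j * X \<omega> $ j)) t =
      (\<Prod>j\<in>UNIV. char (distr M borel (\<lambda>\<omega>. \<beta> $ j * X \<omega> $ j)) t)"
    by (rule char_distr_sum, rule indep_vars_compose2[OF indep]) auto
  also have "\<dots> = (\<Prod>j\<in>UNIV. char (density lborel (\<lambda>x. ennreal (f x))) (\<beta> $ j / l $ j * t))"
  proof (rule prod.cong[OF refl])
    fix j
    have [measurable]: "(\<lambda>\<omega>. X \<omega> $ j) \<in> borel_measurable M"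
      using X[of j] by (auto simp: distributed_def)
    have "char (distr M borel (\<lambda>\<omega>. \<beta> $ j * X \<omega> $ j)) t = char (distr M borel (\<lambda>\<omega>. X \<omega> $ j)) (\<beta> $ j * t)"
      unfolding char_def by (simp add: integral_distr mult_ac)
    also have "\<dots> = char (density lborel (\<lambda>x. ennreal (f x))) (\<beta> $ j * t / l $ j)"
      by (rule char_distributed_scaled_density[OF f l X])
    finally show "char (distr M borel (\<lambda>\<omega>. \<beta> $ j * X \<omega> $ j)) t =
        char (density lborel (\<lambda>x. ennreal (f x))) (\<beta> $ j / l $ j * t)" by simp
  qed
  finally show ?thesis unfolding inner_vec_def inner_real_def .
qed

text \<open>The set where two continuous functions differ is open, so it cannot lie inside the zero set of \<open>k\<close>.\<close>

lemma mult_cancel_of_zeros_nowhere_dense: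
  fixes g h k :: "real \<Rightarrow> complex"
  assumes "continuous_on UNIV g" "continuous_on UNIV h"
    and k: "\<not> (\<exists>a b. a < b \<and> {a<..<b} \<subseteq> {t. k t = 0})"
    and eq: "\<And>t. g t * k t = h t * k t"
  shows "g t = h t"
proof (rule ccontr)
  assume "g t \<noteq> h t"
  have "open {t. g t \<noteq> h t}"
    using assms(1,2) by (rule open_Collect_neq)
  then obtain e where e: "e > 0" "\<And>s. dist s t < e \<Longrightarrow> g s \<noteq> h s"
    using \<open>g t \<noteq> h t\<close> unfolding open_dist by blast
  then have "{t - e<..<t + e} \<subseteq> {t. k t = 0}"
    using eq by (force simp: dist_real_def)
  then show False using k e(1) by (metis less_add_same_cancel1 diff_less_eq less_trans)
qed

section \<open>The coefficient set in terms of the ratios beta_j / lambda_j\<close>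

theorem theorem3:
  fixes f :: "real \<Rightarrow> real"
    and M :: "'a measure" and X :: "'a \<Rightarrow> real ^ 'd" and \<epsilon> :: "'a \<Rightarrow> real"
    and N :: "'b measure" and Y :: "'b \<Rightarrow> real"
    and l \<beta>\<^sub>0 :: "real ^ 'd"
  assumes "CARD('d) \<ge> 2"
    and "prob_density f"
    and "\<not> gaussian_density f"
    and "\<And>m::real. m > 0 \<Longrightarrow> integrable lborel (\<lambda>x. \<bar>x\<bar> powr m * f x)"
    and "\<And>j. l $ j > 0"
    and "prob_space M"
    and "prob_space.indep_vars M (\<lambda>_. borel) (\<lambda>j \<omega>. X \<omega> $ j) UNIV"
    and "\<And>j. distributed M lborel (\<lambda>\<omega>. X \<omega> $ j) (scaled_density (l $ j) f)"
    and "prob_space.indep_rv M borel X borel \<epsilon>"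
    and "\<not> (\<exists>a b. a < b \<and> {a<..<b} \<subseteq> {t. char (distr M borel \<epsilon>) t = 0})"
    and "prob_space N"
    and "Y \<in> borel_measurable N"
    and "eq_in_distr N Y M (\<lambda>\<omega>. \<beta>\<^sub>0 \<bullet> X \<omega> + \<epsilon> \<omega>)"
  shows "{\<beta>. \<exists>\<sigma>. \<sigma> permutes UNIV \<and> (\<forall>j. \<beta> $ j = l $ j / l $ \<sigma> j * \<beta>\<^sub>0 $ \<sigma> j)}
           \<subseteq> coef_set N Y M X \<epsilon> \<and>
         coef_set N Y M X \<epsilon>
           \<subseteq> {\<beta>. \<exists>\<sigma>. \<sigma> permutes UNIV \<and> (\<forall>j. \<bar>\<beta> $ j\<bar> = l $ j / l $ \<sigma> j * \<bar>\<beta>\<^sub>0 $ \<sigma> j\<bar>)} \<and>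
         (symmetric_density f \<longrightarrow> coef_set N Y M X \<epsilon>
           = {\<beta>. \<exists>\<sigma>. \<sigma> permutes UNIV \<and> (\<forall>j. \<bar>\<beta> $ j\<bar> = l $ j / l $ \<sigma> j * \<bar>\<beta>\<^sub>0 $ \<sigma> j\<bar>)})"
proof -
  note f = assms(2) and ng = assms(3) and l = assms(5)
  interpret M: prob_space M by fact
  define D where "D = density lborel (\<lambda>x. ennreal (f x))"
  define b where "b \<beta> j = \<beta> $ j / l $ j" for \<beta> :: "real ^ 'd" and j
  define P where "P \<beta> t = (\<Prod>j\<in>UNIV. char D (b \<beta> j * t))" for \<beta> t
  interpret D: real_distribution D
    unfolding D_def by (rule real_distribution_density[OF f])
  have [measurable]: "X \<in> borel_measurable M" "\<epsilon> \<in> borel_measurable M"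
    using assms(9) unfolding M.indep_rv_def by auto
  have dist: "real_distribution (distr M borel (\<lambda>\<omega>. \<beta> \<bullet> X \<omega> + \<epsilon> \<omega>))" for \<beta>
    by (simp add: real_distribution_def real_distribution_axioms_def M.prob_space_distr)
  have char: "char (distr M borel (\<lambda>\<omega>. \<beta> \<bullet> X \<omega> + \<epsilon> \<omega>)) t = P \<beta> t * char (distr M borel \<epsilon>) t" for \<beta> t
    unfolding P_def D_def b_def by (rule M.char_distr_inner_add[OF f l assms(7,8,9)])
  have cont_char: "continuous_on UNIV (char D)"
    by (simp add: continuous_at_imp_continuous_on D.isCont_char)
  have cont: "continuous_on UNIV (P \<beta>)" for \<beta>
    unfolding P_def
    by (intro continuous_on_prod continuous_on_compose2[OF cont_char] continuous_on_mult
        continuous_on_const continuous_on_id) auto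
  \<comment> \<open>Equality of laws is equality of characteristic functions; the common factor from
    \<epsilon> cancels because both products are continuous and its zeros contain no
    interval.\<close>
  have coef_set: "\<beta> \<in> coef_set N Y M X \<epsilon> \<longleftrightarrow> (\<forall>t. P \<beta> t = P \<beta>\<^sub>0 t)" for \<beta>
  proof -
    let ?L = "\<lambda>\<beta>. distr M borel (\<lambda>\<omega>. \<beta> \<bullet> X \<omega> + \<epsilon> \<omega>)"
    have "\<beta> \<in> coef_set N Y M X \<epsilon> \<longleftrightarrow> ?L \<beta> = ?L \<beta>\<^sub>0"
      using assms(13) unfolding coef_set_def eq_in_distr_def by auto
    also have "\<dots> \<longleftrightarrow> char (?L \<beta>) = char (?L \<beta>\<^sub>0)"
      using Levy_uniqueness[OF dist[of \<beta>] dist[of \<beta>\<^sub>0]] by auto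
    also have "\<dots> \<longleftrightarrow> (\<forall>t. P \<beta> t * char (distr M borel \<epsilon>) t = P \<beta>\<^sub>0 t * char (distr M borel \<epsilon>) t)"
      by (simp only: fun_eq_iff char)
    also have "\<dots> \<longleftrightarrow> (\<forall>t. P \<beta> t = P \<beta>\<^sub>0 t)"
      using mult_cancel_of_zeros_nowhere_dense[OF cont cont assms(10), of \<beta> \<beta>\<^sub>0] by auto
    finally show ?thesis .
  qed
  have b_iff: "\<beta> $ j = l $ j / l $ k * \<beta>' $ k \<longleftrightarrow> b \<beta> j = b \<beta>' k" for \<beta> \<beta>' :: "real ^ 'd" and j k
    using l[of j] l[of k] by (auto simp: b_def field_simps)
  have abs_b_iff: "\<bar>\<beta> $ j\<bar> = l $ j / l $ k * \<bar>\<beta>' $ k\<bar> \<longleftrightarrow> \<bar>b \<beta> j\<bar> = \<bar>b \<beta>' k\<bar>"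
    for \<beta> \<beta>' :: "real ^ 'd" and j k
    using l[of j] l[of k] by (auto simp: b_def field_simps)
  have permute: "P \<beta> t = P \<beta>\<^sub>0 t"
    if "\<sigma> permutes UNIV" "\<And>j. char D (b \<beta> j * t) = char D (b \<beta>\<^sub>0 (\<sigma> j) * t)" for \<beta> \<sigma> t
    unfolding P_def that(2) by (rule prod.permute[OF that(1), unfolded comp_def, symmetric])
  have sup: "coef_set N Y M X \<epsilon>
      \<subseteq> {\<beta>. \<exists>\<sigma>. \<sigma> permutes UNIV \<and> (\<forall>j. \<bar>\<beta> $ j\<bar> = l $ j / l $ \<sigma> j * \<bar>\<beta>\<^sub>0 $ \<sigma> j\<bar>)}"
  proof
    fix \<beta> assume "\<beta> \<in> coef_set N Y M X \<epsilon>"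
    then have eq: "(\<Prod>j\<in>UNIV. char D (b \<beta> j * t)) = (\<Prod>j\<in>UNIV. char D (b \<beta>\<^sub>0 j * t))" for t
      unfolding coef_set P_def by blast
    have moments: "integrable D (\<lambda>x. x ^ k)" for k
      unfolding D_def by (rule moments_density[OF f assms(4)])
    \<comment> \<open>Different multisets would make the characteristic function of f an exponential
      of a quadratic, hence f Gaussian; equal multisets yield the permutation.\<close>
    have "image_mset (\<lambda>j. \<bar>b \<beta> j\<bar>) (mset_set UNIV) = image_mset (\<lambda>j. \<bar>b \<beta>\<^sub>0 j\<bar>) (mset_set UNIV)"
    proof (rule ccontr)
      assume "image_mset (\<lambda>j. \<bar>b \<beta> j\<bar>) (mset_set UNIV) \<noteq> image_mset (\<lambda>j. \<bar>b \<beta>\<^sub>0 j\<bar>) (mset_set UNIV)"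
      from D.char_prod_eq_imp_quadratic[OF finite_class.finite_UNIV moments eq this]
      have "gaussian_density f"
        using gaussian_density_of_char[OF f] unfolding D_def by blast
      then show False using ng by blast
    qed
    then obtain \<sigma> where "\<sigma> permutes UNIV" "\<forall>j\<in>UNIV. \<bar>b \<beta> j\<bar> = \<bar>b \<beta>\<^sub>0 (\<sigma> j)\<bar>"
      by (rule image_mset_eq_implies_permutes[OF finite_class.finite_UNIV])
    then show "\<beta> \<in> {\<beta>. \<exists>\<sigma>. \<sigma> permutes UNIV \<and> (\<forall>j. \<bar>\<beta> $ j\<bar> = l $ j / l $ \<sigma> j * \<bar>\<beta>\<^sub>0 $ \<sigma> j\<bar>)}"
      unfolding abs_b_iff by blast
  qed
  moreover have "{\<beta>. \<exists>\<sigma>. \<sigma> permutes UNIV \<and> (\<forall>j. \<beta> $ j = l $ j / l $ \<sigma> j * \<beta>\<^sub>0 $ \<sigma> j)} \<subseteq> coef_set N Y M X \<epsilon>"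
  proof
    fix \<beta> assume "\<beta> \<in> {\<beta>. \<exists>\<sigma>. \<sigma> permutes UNIV \<and> (\<forall>j. \<beta> $ j = l $ j / l $ \<sigma> j * \<beta>\<^sub>0 $ \<sigma> j)}"
    then obtain \<sigma> where "\<sigma> permutes UNIV" "\<And>j. b \<beta> j = b \<beta>\<^sub>0 (\<sigma> j)"
      unfolding b_iff by blast
    then show "\<beta> \<in> coef_set N Y M X \<epsilon>"
      unfolding coef_set using permute by auto
  qed
  moreover have "{\<beta>. \<exists>\<sigma>. \<sigma> permutes UNIV \<and> (\<forall>j. \<bar>\<beta> $ j\<bar> = l $ j / l $ \<sigma> j * \<bar>\<beta>\<^sub>0 $ \<sigma> j\<bar>)} \<subseteq> coef_set N Y M X \<epsilon>"
    if sym: "symmetric_density f"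
  proof
    fix \<beta> assume "\<beta> \<in> {\<beta>. \<exists>\<sigma>. \<sigma> permutes UNIV \<and> (\<forall>j. \<bar>\<beta> $ j\<bar> = l $ j / l $ \<sigma> j * \<bar>\<beta>\<^sub>0 $ \<sigma> j\<bar>)}"
    then obtain \<sigma> where \<sigma>: "\<sigma> permutes UNIV" "\<And>j. \<bar>b \<beta> j\<bar> = \<bar>b \<beta>\<^sub>0 (\<sigma> j)\<bar>"
      unfolding abs_b_iff by blast
    \<comment> \<open>By symmetry the characteristic function is even, so agreement of the ratios up
      to sign suffices.\<close>
    have "char D (b \<beta> j * t) = char D (b \<beta>\<^sub>0 (\<sigma> j) * t)" for j t
      using \<sigma>(2)[of j] char_symmetric_density[OF f sym, of "b \<beta>\<^sub>0 (\<sigma> j) * t"]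
      unfolding D_def by (auto simp: abs_eq_iff)
    then show "\<beta> \<in> coef_set N Y M X \<epsilon>"
      unfolding coef_set using permute[OF \<sigma>(1)] by blast
  qed
  ultimately show ?thesis by blast
qed

end
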